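(* Let $\xi=\exp(2\pi i/7)$, let $B=\mathbb{Q}(\pi,\xi)\subset\mathbb{C}$, and let $G$ be the subgroup of $B^\times$ generated by $\pi$ and $\xi$. The invariant $\Delta(M,\omega)$ corresponding to the 1-palette $(B,G)$ distinguishes the lens spaces $L(7,1)$ and $L(7,2)$. More concretely, there exists a cohomology class $\omega_0:H_1(L(7,1),\mathbb{Z})\to G$ (non-trivial) such that for every non-trivial cohomology class $\omega:H_1(L(7,2),\mathbb{Z})\to G$, $$\Delta(L(7,1),\omega_0)\neq\Delta(L(7,2),\omega).$$
   Context: **Invariant of links.** Let $B$ be a field of characteristic $0$ and $G$ a subgroup of $B^\times$ (a 1-palette $(B,G)$). For $t\in G$ with $t^4\neq1$ put $d(t)=\frac1{t^2-t^{-2}}$. Let $L\subset S^3$ be a non-empty oriented framed link, each component having a color $(t,N)\in(G\setminus\{g:g^4=1\})\times\mathbb{Z}$. The $\mathfrak{gl}(1|1)$-Alexander polynomial $\Delta(L)\in B$ (Viro) is computed from a diagram with blackboard framing: cut the diagram at a point of an arc, of color $(t,N)$, adjacent to the unbounded region, and put it in Morse position so that the two new endpoints are at the bottom and at the top. A point with color $(t,N)$ on a horizontal level carries the $B$-vector space $U(t,N)_+$ if the strand points upward and $U(t,N)_-$ if downward, each with basis $e_0,e_1$; a level carries the tensor product from left to right. Each elementary piece is a linear map read from bottom to top ($e_{ij}=e_i\otimes e_j$); the composite is a scalar multiple of the identity, and $\Delta(L)$ is this scalar times $d(t)$. The maps are: Cups, color $(u,U)$: $1\mapsto e_{00}-u^2e_{11}$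 into $U_+\otimes U_-$; $1\mapsto u^{-2}e_{00}+e_{11}$ into $U_-\otimes U_+$. Caps: on $U_-\otimes U_+$, $e_{00}\mapsto1$, $e_{11}\mapsto-u^{-2}$; on $U_+\otimes U_-$, $e_{00}\mapsto u^2$, $e_{11}\mapsto1$ (others to $0$). Crossings of two upward strands, bottom left color $(v,V)$, bottom right color $(u,U)$. Positive (strand from bottom left to top right over): $e_{00}\mapsto v^{1-U}u^{1-V}e_{00}$, $e_{01}\mapsto v^{-1-U}u^{1-V}e_{10}+(v^4-1)v^{-1-U}u^{-1-V}e_{01}$, $e_{10}\mapsto v^{1-U}u^{-1-V}e_{01}$, $e_{11}\mapsto-v^{-1-U}u^{-1-V}e_{11}$. Negative (strand from bottom right to top left over): $e_{00}\mapsto v^{U-1}u^{V-1}e_{00}$, $e_{01}\mapsto v^{U+1}u^{V-1}e_{10}$, $e_{10}\mapsto v^{U-1}u^{V+1}e_{01}+(1-u^4)v^{U-1}u^{V-1}e_{10}$, $e_{11}\mapsto-v^{U+1}u^{V+1}e_{11}$. Crossings in other positions are obtained by bending strands with cups and caps. **Kirby color.** Giving a component $K$ the Kirby color $\Omega(t,N)$ means that $\Delta$ is computed as $d(t)$ times $\Delta$ with $K$ colored $(t,N)$ minus $d(t)$ times $\Delta$ with $K$ replaced by $-K$ (reversed orientation) colored $(t^{-1},2-N)$; for several components expand multilinearly. **Invariant of 3-manifolds.** Suppose $G$ is finitely generated and contains $\mathbb{Z}$ but no $\mathbb{Z}/2\mathbb{Z}$ as a subgroup. For a closed connected oriented 3-manifold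 $M$ and a non-trivial homomorphism (cohomology class) $\omega:H_1(M,\mathbb{Z})\to G$, choose a non-empty oriented framed link $L\subset S^3$ such that surgery along $L$ gives $M$ and $\omega([m_K])\neq1$ for the meridian $m_K$ of every component $K$ of $L$ (a computable surgery presentation). Color each $K$ by $\Omega(\omega([m_K]),1)$ and set $$\Delta(M,\omega)=\frac{\Delta(L)}{2^{r(L)}(-1)^{\sigma_+(L)}},$$ with $r(L)$ the number of components of $L$ and $\sigma_+(L)$ the number of positive eigenvalues of its linking matrix (framings on the diagonal). This is independent of the choice of $L$. **Lens spaces.** For positive integers $m,n$, $L(mn-1,n)$ denotes the manifold obtained by surgery on the oriented Hopf link with linking number $-1$ and framings $m$, $n$; thus $H_1$ is generated by the meridians $[m_1],[m_2]$ with relations $m[m_1]=[m_2]$, $n[m_2]=[m_1]$. $L(7,1)$ is the case $m=8,n=1$ and $L(7,2)$ is the case $m=4,n=2$. *)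

theory Defs
  imports
    Complex_Main
    "HOL-Algebra.Generated_Fields"
    "HOL-Algebra.Free_Abelian_Groups"
    "HOL-Algebra.Elementary_Groups"
    "HOL-Algebra.Algebraic_Closure_Type"
    "Jordan_Normal_Form.Char_Poly"
begin

section \<open>Palettes\<close>

text \<open>
  The field \<open>B\<close> and the group \<open>G\<close> of a palette are subsets of an ambient field type of
  characteristic 0, so that \<open>B\<close> has characteristic 0 automatically.
\<close>

definition field_units :: "'a::field_char_0 set \<Rightarrow> 'a monoid" where
  "field_units B = mult_of (ring_of_type_algebra\<lparr>carrier := B\<rparr>)"

definition palette_group :: "'a::field_char_0 set \<Rightarrow> 'a set \<Rightarrow> 'a monoid" where
  "palette_group B G = (field_units B)\<lparr>carrier := G\<rparr>"

definition one_palette :: "'a::field_char_0 set \<Rightarrow> 'a set \<Rightarrow> bool" where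
  "one_palette B G \<longleftrightarrow> subfield B ring_of_type_algebra \<and> subgroup G (field_units B)"

definition contains_copy :: "('a, 'c) monoid_scheme \<Rightarrow> ('b, 'd) monoid_scheme \<Rightarrow> bool" where
  "contains_copy A K \<longleftrightarrow> (\<exists>H. subgroup H A \<and> A\<lparr>carrier := H\<rparr> \<cong> K)"

definition manifold_palette :: "'a::field_char_0 set \<Rightarrow> 'a set \<Rightarrow> bool" where
  "manifold_palette B G \<longleftrightarrow> one_palette B G
     \<and> (\<exists>S. finite S \<and> S \<subseteq> G \<and> generate (field_units B) S = G)
     \<and> contains_copy (palette_group B G) integer_group
     \<and> \<not> contains_copy (palette_group B G) (integer_mod_group 2)"


section \<open>Link diagrams in Morse position\<close>

text \<open>
  A point of a horizontal level is given by the component it lies on and by whether the strand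
  points upward there; a level is listed from left to right.  Components are numbered from 0.
\<close>

type_synonym strand = "nat \<times> bool"

definition opp :: "strand \<Rightarrow> strand" where
  "opp s = (fst s, \<not> snd s)"

text \<open>
  \<open>Cup i s\<close> creates the strands \<open>s\<close>, \<open>opp s\<close> at positions \<open>i\<close>, \<open>i + 1\<close>; \<open>Cap i\<close> and
  \<open>Cross i o\<close> act on positions \<open>i\<close>, \<open>i + 1\<close>.  In \<open>Cross i o\<close> the strand running between bottom
  left and top right is the over-strand iff \<open>o\<close> holds, whatever the orientations are.
\<close>

datatype piece = Cup nat strand | Cap nat | Cross nat bool

fun step :: "piece \<Rightarrow> 'l list \<Rightarrow> (strand \<Rightarrow> 'l list) \<Rightarrow> 'l list" where
  "step (Cup i s) l new = take i l @ new s @ drop i l"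
| "step (Cap i) l new = take i l @ drop (i + 2) l"
| "step (Cross i ov) l new = take i l @ [l ! (i + 1), l ! i] @ drop (i + 2) l"

abbreviation next_level :: "piece \<Rightarrow> strand list \<Rightarrow> strand list" where
  "next_level p l \<equiv> step p l (\<lambda>s. [s, opp s])"

fun fits :: "piece \<Rightarrow> strand list \<Rightarrow> bool" where
  "fits (Cup i s) l \<longleftrightarrow> i \<le> length l"
| "fits (Cap i) l \<longleftrightarrow> i + 1 < length l \<and> l ! (i + 1) = opp (l ! i)"
| "fits (Cross i ov) l \<longleftrightarrow> i + 1 < length l"

fun tangle :: "strand list \<Rightarrow> piece list \<Rightarrow> strand list \<Rightarrow> bool" where
  "tangle l [] l' \<longleftrightarrow> l = l'"
| "tangle l (p # ps) l' \<longleftrightarrow> fits p l \<and> tangle (next_level p l) ps l'"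

text \<open>
  A link diagram that has been cut at a point next to the unbounded region: the number of
  components of the link, the strand at both new endpoints (bottom and top), and the elementary
  pieces from bottom to top.  The framing is the blackboard framing.
\<close>

datatype cut_link = Cut_Link (components: nat) (cut_strand: strand) (pieces: "piece list")

text \<open>
  Every cup starts a new arc, arc 0 starts at the bottom endpoint, and every cap joins two arcs.
  In a valid diagram two arcs carry the same component number only if they are joined by a
  sequence of caps (the converse is enforced by \<^const>\<open>tangle\<close>).
\<close>

fun arc_joins :: "nat list \<Rightarrow> nat \<Rightarrow> piece list \<Rightarrow> (nat \<times> nat) set" where
  "arc_joins l n [] = {}"
| "arc_joins l n (Cup i s # ps) = arc_joins (step (Cup i s) l (\<lambda>_. [n, n])) (Suc n) ps"
| "arc_joins l n (Cap i # ps) = insert (l ! i, l ! (i + 1)) (arc_joins (step (Cap i) l (\<lambda>_. [])) n ps)"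
| "arc_joins l n (Cross i ov # ps) = arc_joins (step (Cross i ov) l (\<lambda>_. [])) n ps"

fun cup_components :: "piece list \<Rightarrow> nat list" where
  "cup_components [] = []"
| "cup_components (Cup i s # ps) = fst s # cup_components ps"
| "cup_components (Cap i # ps) = cup_components ps"
| "cup_components (Cross i ov # ps) = cup_components ps"

definition link_diagram :: "cut_link \<Rightarrow> bool" where
  "link_diagram D \<longleftrightarrow>
     (let arcs = fst (cut_strand D) # cup_components (pieces D);
          J = arc_joins [0] 1 (pieces D)
      in tangle [cut_strand D] (pieces D) [cut_strand D]
         \<and> set arcs = {..<components D}
         \<and> (\<forall>a < length arcs. \<forall>b < length arcs. arcs ! a = arcs ! b \<longrightarrow> (a, b) \<in> (J \<union> J\<inverse>)\<^sup>*))"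

definition reverse_strand :: "nat set \<Rightarrow> strand \<Rightarrow> strand" where
  "reverse_strand S s = (if fst s \<in> S then opp s else s)"

fun reverse_piece :: "nat set \<Rightarrow> piece \<Rightarrow> piece" where
  "reverse_piece S (Cup i s) = Cup i (reverse_strand S s)"
| "reverse_piece S (Cap i) = Cap i"
| "reverse_piece S (Cross i ov) = Cross i ov"

definition reverse_components :: "nat set \<Rightarrow> cut_link \<Rightarrow> cut_link" where
  "reverse_components S D =
     Cut_Link (components D) (reverse_strand S (cut_strand D)) (map (reverse_piece S) (pieces D))"


section \<open>Linking matrix\<close>

definition crossing_sign :: "bool \<Rightarrow> strand \<Rightarrow> strand \<Rightarrow> int" where
  "crossing_sign ov a b = (if ov = (snd a = snd b) then 1 else -1)"

text \<open>The sum of the signs of all crossings between component \<open>j\<close> and component \<open>k\<close>.\<close>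

fun sign_sum :: "nat \<Rightarrow> nat \<Rightarrow> strand list \<Rightarrow> piece list \<Rightarrow> int" where
  "sign_sum j k l [] = 0"
| "sign_sum j k l (Cross i ov # ps) =
     (if {fst (l ! i), fst (l ! (i + 1))} = {j, k} then crossing_sign ov (l ! i) (l ! (i + 1)) else 0)
     + sign_sum j k (next_level (Cross i ov) l) ps"
| "sign_sum j k l (p # ps) = sign_sum j k (next_level p l) ps"

definition linking :: "cut_link \<Rightarrow> nat \<Rightarrow> nat \<Rightarrow> int" where
  "linking D j k =
     (if j = k then sign_sum j j [cut_strand D] (pieces D)
      else sign_sum j k [cut_strand D] (pieces D) div 2)"

definition linking_matrix :: "cut_link \<Rightarrow> real mat" where
  "linking_matrix D = mat (components D) (components D) (\<lambda>(j, k). of_int (linking D j k))"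

definition sigma_plus :: "cut_link \<Rightarrow> nat" where
  "sigma_plus D = (\<Sum>x \<in> {x. 0 < x \<and> eigenvalue (linking_matrix D) x}.
                     Polynomial.order x (char_poly (linking_matrix D)))"


section \<open>The Alexander polynomial of coloured links\<close>

text \<open>
  \<open>E0\<close>, \<open>E1\<close> index the basis of each of the spaces \<open>U(t, N)\<^sub>+\<close>, \<open>U(t, N)\<^sub>-\<close>.  A vector of a tensor
  product of \<open>n\<close> such spaces is given by its coordinates, a function on words that vanishes
  outside the words of length \<open>n\<close>.  A linear map is given by the images of the basis vectors.
\<close>

datatype index = E0 | E1

type_synonym 'a tensor = "index list \<Rightarrow> 'a"

definition bvec :: "index list \<Rightarrow> 'a::field_char_0 tensor" where
  "bvec w = (\<lambda>x. if x = w then 1 else 0)"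

definition dfac :: "'a::field_char_0 \<Rightarrow> 'a" where
  "dfac t = 1 / (t\<^sup>2 - t powi (-2))"

text \<open>The Boolean argument says whether the left one of the two strands points upward.\<close>

fun cup_map :: "'a::field_char_0 \<Rightarrow> bool \<Rightarrow> index list \<Rightarrow> 'a tensor" where
  "cup_map u True [] = (\<lambda>x. bvec [E0,E0] x - u\<^sup>2 * bvec [E1,E1] x)"
| "cup_map u False [] = (\<lambda>x. u powi (-2) * bvec [E0,E0] x + bvec [E1,E1] x)"
| "cup_map u _ _ = (\<lambda>x. 0)"

fun cap_map :: "'a::field_char_0 \<Rightarrow> bool \<Rightarrow> index list \<Rightarrow> 'a tensor" where
  "cap_map u False [E0,E0] = bvec []"
| "cap_map u False [E1,E1] = (\<lambda>x. - (u powi (-2)) * bvec [] x)"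
| "cap_map u True [E0,E0] = (\<lambda>x. u\<^sup>2 * bvec [] x)"
| "cap_map u True [E1,E1] = bvec []"
| "cap_map u _ _ = (\<lambda>x. 0)"

text \<open>Crossings of two upward strands with bottom left colour \<open>(v, V)\<close>, bottom right \<open>(u, U)\<close>.\<close>

fun pos_crossing :: "'a::field_char_0 \<times> int \<Rightarrow> 'a \<times> int \<Rightarrow> index list \<Rightarrow> 'a tensor" where
  "pos_crossing (v,V) (u,U) [E0,E0] = (\<lambda>x. v powi (1-U) * u powi (1-V) * bvec [E0,E0] x)"
| "pos_crossing (v,V) (u,U) [E0,E1] =
     (\<lambda>x. v powi (-1-U) * u powi (1-V) * bvec [E1,E0] x
        + (v^4 - 1) * v powi (-1-U) * u powi (-1-V) * bvec [E0,E1] x)"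
| "pos_crossing (v,V) (u,U) [E1,E0] = (\<lambda>x. v powi (1-U) * u powi (-1-V) * bvec [E0,E1] x)"
| "pos_crossing (v,V) (u,U) [E1,E1] = (\<lambda>x. - (v powi (-1-U)) * u powi (-1-V) * bvec [E1,E1] x)"
| "pos_crossing _ _ _ = (\<lambda>x. 0)"

fun neg_crossing :: "'a::field_char_0 \<times> int \<Rightarrow> 'a \<times> int \<Rightarrow> index list \<Rightarrow> 'a tensor" where
  "neg_crossing (v,V) (u,U) [E0,E0] = (\<lambda>x. v powi (U-1) * u powi (V-1) * bvec [E0,E0] x)"
| "neg_crossing (v,V) (u,U) [E0,E1] = (\<lambda>x. v powi (U+1) * u powi (V-1) * bvec [E1,E0] x)"
| "neg_crossing (v,V) (u,U) [E1,E0] =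
     (\<lambda>x. v powi (U-1) * u powi (V+1) * bvec [E0,E1] x
        + (1 - u^4) * v powi (U-1) * u powi (V-1) * bvec [E1,E0] x)"
| "neg_crossing (v,V) (u,U) [E1,E1] = (\<lambda>x. - (v powi (U+1)) * u powi (V+1) * bvec [E1,E1] x)"
| "neg_crossing _ _ _ = (\<lambda>x. 0)"

text \<open>
  The map \<open>id \<otimes> M \<otimes> id\<close>, where \<open>M\<close> maps tensors on the positions \<open>i, \<dots>, i + p - 1\<close> to tensors on
  the positions \<open>i, \<dots>, i + q - 1\<close>.
\<close>

definition apply_at ::
    "nat \<Rightarrow> nat \<Rightarrow> nat \<Rightarrow> (index list \<Rightarrow> 'a::field_char_0 tensor) \<Rightarrow> 'a tensor \<Rightarrow> 'a tensor" where
  "apply_at i p q M f =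
     (\<lambda>w. \<Sum>x \<in> {x. length x = p}. f (take i w @ x @ drop (i + q) w) * M x (take q (drop i w)))"

text \<open>
  The map of an elementary piece above level \<open>l\<close>; crossings are here assumed to be between upward
  strands.
\<close>

fun piece_map ::
    "(nat \<Rightarrow> 'a::field_char_0 \<times> int) \<Rightarrow> strand list \<Rightarrow> piece \<Rightarrow> 'a tensor \<Rightarrow> 'a tensor" where
  "piece_map c l (Cup i s) = apply_at i 0 2 (cup_map (fst (c (fst s))) (snd s))"
| "piece_map c l (Cap i) = apply_at i 2 0 (cap_map (fst (c (fst (l ! i)))) (snd (l ! i)))"
| "piece_map c l (Cross i ov) =
     apply_at i 2 2 ((if ov then pos_crossing else neg_crossing)
                       (c (fst (l ! i))) (c (fst (l ! (i + 1)))))"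

fun tangle_map ::
    "(nat \<Rightarrow> 'a::field_char_0 \<times> int) \<Rightarrow> strand list \<Rightarrow> piece list \<Rightarrow> 'a tensor \<Rightarrow> 'a tensor" where
  "tangle_map c l [] f = f"
| "tangle_map c l (p # ps) f = tangle_map c (next_level p l) ps (piece_map c l p f)"

text \<open>
  \<open>bend a b i ov\<close> is an isotopic redrawing of \<open>Cross i ov\<close> on bottom strands \<open>a\<close>, \<open>b\<close> that bends
  the downward strands with cups and caps until the crossing is between upward strands.
  Rotating a crossing by a quarter turn exchanges the two kinds of crossing.
\<close>

definition bend :: "strand \<Rightarrow> strand \<Rightarrow> nat \<Rightarrow> bool \<Rightarrow> piece list" where
  "bend a b i ov =
     (if snd a \<and> snd b then [Cross i ov]
      else if snd a then [Cup i b, Cross (i + 1) (\<not> ov), Cap (i + 2)]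
      else if snd b then [Cup (i + 2) (opp a), Cross (i + 1) (\<not> ov), Cap i]
      else [Cup i b, Cup (i + 1) a, Cross (i + 2) ov, Cap (i + 3), Cap (i + 2)])"

fun bend_crossings :: "strand list \<Rightarrow> piece list \<Rightarrow> piece list" where
  "bend_crossings l [] = []"
| "bend_crossings l (Cross i ov # ps) =
     bend (l ! i) (l ! (i + 1)) i ov @ bend_crossings (next_level (Cross i ov) l) ps"
| "bend_crossings l (p # ps) = p # bend_crossings (next_level p l) ps"

definition cut_map :: "cut_link \<Rightarrow> (nat \<Rightarrow> 'a::field_char_0 \<times> int) \<Rightarrow> 'a tensor \<Rightarrow> 'a tensor" where
  "cut_map D c = tangle_map c [cut_strand D] (bend_crossings [cut_strand D] (pieces D))"

definition Alexander :: "cut_link \<Rightarrow> (nat \<Rightarrow> 'a::field_char_0 \<times> int) \<Rightarrow> 'a" where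
  "Alexander D c =
     (THE s. \<forall>i. cut_map D c (bvec [i]) = (\<lambda>w. s * bvec [i] w)) * dfac (fst (c (fst (cut_strand D))))"

text \<open>
  All components are given the Kirby colours \<open>\<Omega>(t, N)\<close>; in the expansion, \<open>S\<close> is the set of
  components that contribute their second term.
\<close>

definition Kirby_Alexander :: "cut_link \<Rightarrow> (nat \<Rightarrow> 'a::field_char_0 \<times> int) \<Rightarrow> 'a" where
  "Kirby_Alexander D c =
     (\<Sum>S \<in> Pow {..<components D}.
        (\<Prod>k<components D. if k \<in> S then - dfac (fst (c k)) else dfac (fst (c k)))
        * Alexander (reverse_components S D)
            (\<lambda>k. if k \<in> S then (inverse (fst (c k)), 2 - snd (c k)) else c k))"


section \<open>The invariant of closed 3-manifolds with a cohomology class\<close>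

text \<open>
  A closed 3-manifold is given by a framed link on which surgery yields it.  Its first homology
  is the abelian group generated by the meridians, with the rows of the linking matrix as
  relations.
\<close>

definition surgery_relation :: "cut_link \<Rightarrow> nat \<Rightarrow> nat \<Rightarrow>\<^sub>0 int" where
  "surgery_relation D k = (\<Sum>j<components D. frag_cmul (linking D k j) (frag_of j))"

definition surgery_relations :: "cut_link \<Rightarrow> (nat \<Rightarrow>\<^sub>0 int) set" where
  "surgery_relations D =
     generate (free_Abelian_group {..<components D}) (surgery_relation D ` {..<components D})"

definition H1 :: "cut_link \<Rightarrow> (nat \<Rightarrow>\<^sub>0 int) set monoid" where
  "H1 D = free_Abelian_group {..<components D} Mod surgery_relations D"

definition meridian :: "cut_link \<Rightarrow> nat \<Rightarrow> (nat \<Rightarrow>\<^sub>0 int) set" where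
  "meridian D k = surgery_relations D #>\<^bsub>free_Abelian_group {..<components D}\<^esub> frag_of k"

definition nontrivial_class ::
    "'a::field_char_0 set \<Rightarrow> 'a set \<Rightarrow> cut_link \<Rightarrow> ((nat \<Rightarrow>\<^sub>0 int) set \<Rightarrow> 'a) \<Rightarrow> bool" where
  "nontrivial_class B G D \<omega> \<longleftrightarrow>
     \<omega> \<in> hom (H1 D) (palette_group B G) \<and> (\<exists>x \<in> carrier (H1 D). \<omega> x \<noteq> 1)"

definition computable_presentation ::
    "'a::field_char_0 set \<Rightarrow> 'a set \<Rightarrow> cut_link \<Rightarrow> ((nat \<Rightarrow>\<^sub>0 int) set \<Rightarrow> 'a) \<Rightarrow> bool" where
  "computable_presentation B G D \<omega> \<longleftrightarrow>
     link_diagram D \<and> nontrivial_class B G D \<omega> \<and> (\<forall>k<components D. \<omega> (meridian D k) \<noteq> 1)"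

text \<open>
  The value of the invariant for the manifold presented by \<open>D\<close>, computed from that presentation.
  It is left unspecified if the palette is not admissible or \<open>D\<close> is not computable for \<open>\<omega>\<close>.
\<close>

definition Alexander_manifold ::
    "'a::field_char_0 set \<Rightarrow> 'a set \<Rightarrow> cut_link \<Rightarrow> ((nat \<Rightarrow>\<^sub>0 int) set \<Rightarrow> 'a) \<Rightarrow> 'a" where
  "Alexander_manifold B G D \<omega> =
     (if manifold_palette B G \<and> computable_presentation B G D \<omega>
      then Kirby_Alexander D (\<lambda>k. (\<omega> (meridian D k), 1))
           / (2 ^ components D * (-1) ^ sigma_plus D)
      else undefined)"


section \<open>Lens spaces\<close>

text \<open>A positive kink, of writhe 1, on an upward strand of component \<open>k\<close> at position \<open>i\<close>.\<close>

definition kink :: "nat \<Rightarrow> nat \<Rightarrow> piece list" where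
  "kink i k = [Cup (i + 1) (k, True), Cross i True, Cap (i + 1)]"

text \<open>
  The oriented Hopf link with linking number \<open>-1\<close> and framings \<open>m\<close>, \<open>n\<close>, cut at component 0;
  component 1 is an unknot around the cut strand.  Surgery yields the lens space \<open>L(mn - 1, n)\<close>.
\<close>

definition lens_space :: "nat \<Rightarrow> nat \<Rightarrow> cut_link" where
  "lens_space m n = Cut_Link 2 (0, True)
     (concat (replicate m (kink 0 0))
      @ [Cup 1 (1, True)]
      @ concat (replicate n (kink 1 1))
      @ [Cross 0 False, Cross 0 False, Cap 1])"

end

theory Submission
  imports Defs
begin

text \<open>
  For every choice of orientations a kink multiplies the tangle map by \<open>t\<^sup>-\<^sup>2\<close>, and the clasp of the
  Hopf link multiplies it by a monomial times \<open>t\<^sup>2 - t\<^sup>-\<^sup>2\<close>.  The surgery relations \<open>a\<^sup>m = b\<close>,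
  \<open>b\<^sup>n = a\<close> for the values \<open>a\<close>, \<open>b\<close> of the class on the meridians cancel all monomials, so that the
  four terms of the Kirby expansion agree and the invariant is \<open>\<plusminus>d(a)d(b)\<close>, up to sign the Reidemeister
  torsion.  Here \<open>a\<close> is a seventh root of unity, so the absolute value is
  \<open>1/(\<bar>a\<^sup>4 - 1\<bar>\<bar>b\<^sup>4 - 1\<bar>)\<close>, a product of inverse chord lengths of the regular heptagon.  For \<open>L(7,1)\<close>
  we have \<open>a = b\<close>, and \<open>a = \<xi>\<^sup>2\<close> makes both chords sides of the heptagon; for \<open>L(7,2)\<close> we have
  \<open>b = a\<^sup>4\<close>, and the two chords have different lengths, so the value is strictly smaller.
\<close>

section \<open>Tangle maps\<close>

definition supported :: "nat \<Rightarrow> 'a::field_char_0 tensor \<Rightarrow> bool" where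
  "supported n f \<longleftrightarrow> (\<forall>w. length w \<noteq> n \<longrightarrow> f w = 0)"

lemma words_0: "{x::index list. length x = 0} = {[]}"
  by auto

lemma words_2: "{x::index list. length x = 2} = {[E0,E0],[E0,E1],[E1,E0],[E1,E1]}"
proof -
  have "x \<in> {[E0,E0],[E0,E1],[E1,E0],[E1,E1]}" if "length x = 2" for x :: "index list"
  proof -
    from that obtain a b where "x = [a, b]"
      by (auto simp: numeral_2_eq_2 length_Suc_conv)
    then show ?thesis by (cases a; cases b) auto
  qed
  then show ?thesis by auto
qed

lemma apply_at_0:
  "apply_at i 0 q M f w = f (take i w @ drop (i + q) w) * M [] (take q (drop i w))"
  by (simp add: apply_at_def words_0)

lemma apply_at_2:
  "apply_at i 2 q M f w =
     f (take i w @ [E0,E0] @ drop (i + q) w) * M [E0,E0] (take q (drop i w))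
   + f (take i w @ [E0,E1] @ drop (i + q) w) * M [E0,E1] (take q (drop i w))
   + f (take i w @ [E1,E0] @ drop (i + q) w) * M [E1,E0] (take q (drop i w))
   + f (take i w @ [E1,E1] @ drop (i + q) w) * M [E1,E1] (take q (drop i w))"
  unfolding apply_at_def words_2 by simp

lemma supported_apply_at:
  assumes f: "supported n f" and M: "\<And>x. length x = p \<Longrightarrow> supported q (M x)" and n: "i + p \<le> n"
  shows "supported (n - p + q) (apply_at i p q M f)"
  unfolding supported_def
proof (intro allI impI)
  fix w :: "index list" assume w: "length w \<noteq> n - p + q"
  have "f (take i w @ x @ drop (i + q) w) * M x (take q (drop i w)) = 0" if x: "length x = p" for x
  proof (cases "i + q \<le> length w")
    case True
    then have "length (take i w @ x @ drop (i + q) w) \<noteq> n" using w x n by simp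
    then show ?thesis using f by (simp add: supported_def)
  next
    case False
    show ?thesis
    proof (cases "length (take q (drop i w)) = q")
      case True
      with False have "q = 0" "length w < i" by (auto simp: min_def split: if_splits)
      then have "length (take i w @ x @ drop (i + q) w) \<noteq> n" using x n by simp
      then show ?thesis using f by (simp add: supported_def)
    next
      case False
      then show ?thesis using M[OF x] by (simp add: supported_def)
    qed
  qed
  then show "apply_at i p q M f w = 0"
    unfolding apply_at_def by (intro sum.neutral) auto
qed

lemma supported_cup_map: "supported 2 (cup_map u o' x)"
  by (cases "(u, o', x)" rule: cup_map.cases) (auto simp: supported_def bvec_def)

lemma supported_cap_map: "supported 0 (cap_map u o' x)"
  by (cases "(u, o', x)" rule: cap_map.cases) (auto simp: supported_def bvec_def)

lemma supported_pos_crossing: "supported 2 (pos_crossing a b x)"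
  by (cases "(a, b, x)" rule: pos_crossing.cases) (auto simp: supported_def bvec_def)

lemma supported_neg_crossing: "supported 2 (neg_crossing a b x)"
  by (cases "(a, b, x)" rule: neg_crossing.cases) (auto simp: supported_def bvec_def)

lemma supported_piece_map:
  assumes "supported (length l) f" "fits p l"
  shows "supported (length (next_level p l)) (piece_map c l p f)"
proof (cases p)
  case (Cup i s)
  then show ?thesis
    using supported_apply_at[OF assms(1), of 0 2 "cup_map (fst (c (fst s))) (snd s)" i] assms(2)
    by (simp add: supported_cup_map)
next
  case (Cap i)
  then show ?thesis
    using supported_apply_at[OF assms(1), of 2 0 "cap_map (fst (c (fst (l ! i)))) (snd (l ! i))" i]
      assms(2)
    by (simp add: supported_cap_map)
next
  case (Cross i ov)
  then show ?thesis
    using supported_apply_at[OF assms(1), of 2 2 "(if ov then pos_crossing else neg_crossing)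
                       (c (fst (l ! i))) (c (fst (l ! (i + 1))))" i] assms(2)
    by (simp add: supported_pos_crossing supported_neg_crossing)
qed

lemma supported_tangle_map:
  "tangle l ps l' \<Longrightarrow> supported (length l) f \<Longrightarrow> supported (length l') (tangle_map c l ps f)"
proof (induction ps arbitrary: l f)
  case (Cons p ps)
  then show ?case by (simp add: supported_piece_map)
qed simp

abbreviation level_after :: "strand list \<Rightarrow> piece list \<Rightarrow> strand list" where
  "level_after l ps \<equiv> fold next_level ps l"

lemma tangle_append: "tangle l (ps @ qs) l' \<longleftrightarrow> tangle l ps (level_after l ps) \<and> tangle (level_after l ps) qs l'"
  by (induction ps arbitrary: l) auto

lemma tangle_map_append:
  "tangle_map c l (ps @ qs) f = tangle_map c (level_after l ps) qs (tangle_map c l ps f)"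
  by (induction ps arbitrary: l f) auto

lemma bend_crossings_append:
  "bend_crossings l (ps @ qs) = bend_crossings l ps @ bend_crossings (level_after l ps) qs"
proof (induction ps arbitrary: l)
  case (Cons p ps)
  then show ?case by (cases p) auto
qed simp

lemma split_at_two:
  assumes "Suc i < length l"
  obtains u a b v where "l = u @ a # b # v" "length u = i"
proof
  show "l = take i l @ l ! i # l ! Suc i # drop (Suc (Suc i)) l"
    using assms by (metis Cons_nth_drop_Suc Suc_lessD append_take_drop_id)
  show "length (take i l) = i" using assms by simp
qed

lemma tangle_bend:
  assumes "fits (Cross i ov) l"
  shows "tangle l (bend (l ! i) (l ! (i + 1)) i ov) (next_level (Cross i ov) l)"
proof -
  obtain u a b v where l: "l = u @ a # b # v" and i: "i = length u"
    using assms by (auto elim: split_at_two)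
  show ?thesis
    unfolding l i bend_def
    by (cases a; cases b) (auto simp: nth_append opp_def numeral_eq_Suc)
qed

lemma tangle_level_after: "tangle l ps l' \<Longrightarrow> level_after l ps = l'"
  by (induction ps arbitrary: l) auto

lemma tangle_trans: "tangle l ps l' \<Longrightarrow> tangle l' qs l'' \<Longrightarrow> tangle l (ps @ qs) l''"
  by (simp add: tangle_append tangle_level_after)

lemma tangle_bend_crossings: "tangle l ps l' \<Longrightarrow> tangle l (bend_crossings l ps) l'"
proof (induction l ps arbitrary: l' rule: bend_crossings.induct)
  case (2 l i ov ps)
  then have "tangle l (bend (l ! i) (l ! (i + 1)) i ov) (next_level (Cross i ov) l)"
    by (intro tangle_bend) simp
  with 2 show ?case
    by (simp add: tangle_append tangle_level_after)
qed auto

definition bent_map ::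
    "(nat \<Rightarrow> 'a::field_char_0 \<times> int) \<Rightarrow> strand list \<Rightarrow> piece list \<Rightarrow> 'a tensor \<Rightarrow> 'a tensor" where
  "bent_map c l ps = tangle_map c l (bend_crossings l ps)"

lemma supported_bent_map:
  "tangle l ps l' \<Longrightarrow> supported (length l) f \<Longrightarrow> supported (length l') (bent_map c l ps f)"
  unfolding bent_map_def by (intro supported_tangle_map tangle_bend_crossings)

lemma bent_map_append:
  assumes "tangle l ps l'"
  shows "bent_map c l (ps @ qs) f = bent_map c l' qs (bent_map c l ps f)"
  using tangle_level_after[OF assms] tangle_level_after[OF tangle_bend_crossings[OF assms]]
  by (simp add: bent_map_def bend_crossings_append tangle_map_append)

lemma supported_eqI:
  assumes "supported n f" "supported n g" "\<And>w. length w = n \<Longrightarrow> f w = g w"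
  shows "f = g"
  using assms unfolding supported_def by fastforce

lemma supported_scale: "supported n f \<Longrightarrow> supported n (\<lambda>w. f w * s)"
  by (simp add: supported_def)

lemma apply_at_cup:
  "take 2 (drop i w) = [E0,E0] \<Longrightarrow> apply_at i 0 2 (cup_map u True) f w = f (take i w @ drop (i + 2) w)"
  "take 2 (drop i w) = [E1,E1] \<Longrightarrow>
     apply_at i 0 2 (cup_map u True) f w = - f (take i w @ drop (i + 2) w) * u\<^sup>2"
  "take 2 (drop i w) = [E0,E0] \<Longrightarrow>
     apply_at i 0 2 (cup_map u False) f w = f (take i w @ drop (i + 2) w) * u powi (-2)"
  "take 2 (drop i w) = [E1,E1] \<Longrightarrow> apply_at i 0 2 (cup_map u False) f w = f (take i w @ drop (i + 2) w)"
  "take 2 (drop i w) = [E0,E1] \<Longrightarrow> apply_at i 0 2 (cup_map u o') f w = 0"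
  "take 2 (drop i w) = [E1,E0] \<Longrightarrow> apply_at i 0 2 (cup_map u o') f w = 0"
  by (cases o'; simp add: apply_at_0 bvec_def)+

lemma apply_at_cap:
  "apply_at i 2 0 (cap_map u True) f w =
     f (take i w @ [E0,E0] @ drop i w) * u\<^sup>2 + f (take i w @ [E1,E1] @ drop i w)"
  "apply_at i 2 0 (cap_map u False) f w =
     f (take i w @ [E0,E0] @ drop i w) - f (take i w @ [E1,E1] @ drop i w) * u powi (-2)"
  by (simp_all add: apply_at_2 bvec_def)

lemma apply_at_pos_crossing:
  "take 2 (drop i w) = [E0,E0] \<Longrightarrow>
     apply_at i 2 2 (pos_crossing (v,1) (u,1)) f w = f (take i w @ [E0,E0] @ drop (i + 2) w)"
  "take 2 (drop i w) = [E0,E1] \<Longrightarrow>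
     apply_at i 2 2 (pos_crossing (v,1) (u,1)) f w =
       f (take i w @ [E0,E1] @ drop (i + 2) w) * ((v^4 - 1) * v powi (-2) * u powi (-2))
     + f (take i w @ [E1,E0] @ drop (i + 2) w) * u powi (-2)"
  "take 2 (drop i w) = [E1,E0] \<Longrightarrow>
     apply_at i 2 2 (pos_crossing (v,1) (u,1)) f w =
       f (take i w @ [E0,E1] @ drop (i + 2) w) * v powi (-2)"
  "take 2 (drop i w) = [E1,E1] \<Longrightarrow>
     apply_at i 2 2 (pos_crossing (v,1) (u,1)) f w =
       - f (take i w @ [E1,E1] @ drop (i + 2) w) * (v powi (-2) * u powi (-2))"
  by (simp_all add: apply_at_2 bvec_def)

lemma apply_at_neg_crossing:
  "take 2 (drop i w) = [E0,E0] \<Longrightarrow>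
     apply_at i 2 2 (neg_crossing (v,1) (u,1)) f w = f (take i w @ [E0,E0] @ drop (i + 2) w)"
  "take 2 (drop i w) = [E0,E1] \<Longrightarrow>
     apply_at i 2 2 (neg_crossing (v,1) (u,1)) f w = f (take i w @ [E1,E0] @ drop (i + 2) w) * u\<^sup>2"
  "take 2 (drop i w) = [E1,E0] \<Longrightarrow>
     apply_at i 2 2 (neg_crossing (v,1) (u,1)) f w =
       f (take i w @ [E0,E1] @ drop (i + 2) w) * v\<^sup>2
     + f (take i w @ [E1,E0] @ drop (i + 2) w) * (1 - u^4)"
  "take 2 (drop i w) = [E1,E1] \<Longrightarrow>
     apply_at i 2 2 (neg_crossing (v,1) (u,1)) f w =
       - f (take i w @ [E1,E1] @ drop (i + 2) w) * (v\<^sup>2 * u\<^sup>2)"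
  by (simp_all add: apply_at_2 bvec_def)

lemmas crossing_simps = bent_map_def bend_def opp_def reverse_strand_def kink_def
  apply_at_cup apply_at_cap apply_at_pos_crossing apply_at_neg_crossing power_int_minus

lemma tangle_kink_0: "tangle [(k, k \<notin> S)] (map (reverse_piece S) (kink 0 k)) [(k, k \<notin> S)]"
  by (simp add: kink_def opp_def reverse_strand_def)

lemma tangle_kink_1:
  "tangle [p, (k, k \<notin> S), q] (map (reverse_piece S) (kink 1 k)) [p, (k, k \<notin> S), q]"
  by (simp add: kink_def opp_def reverse_strand_def)

lemma bent_map_kink_0:
  fixes t :: "'a::field_char_0"
  assumes "c k = (t, 1)" "t \<noteq> 0" "supported 1 f"
  shows "bent_map c [(k, k \<notin> S)] (map (reverse_piece S) (kink 0 k)) f = (\<lambda>w. f w * t powi (-2))"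
proof (rule supported_eqI)
  show "supported 1 (bent_map c [(k, k \<notin> S)] (map (reverse_piece S) (kink 0 k)) f)"
    using supported_bent_map[OF tangle_kink_0, where f = f] assms(3) by simp
  fix w :: "index list" assume "length w = 1"
  then obtain x where "w = [x]" by (auto simp: length_Suc_conv)
  then show "bent_map c [(k, k \<notin> S)] (map (reverse_piece S) (kink 0 k)) f w = f w * t powi (-2)"
    using assms(1,2) by (cases "k \<in> S"; cases x) (simp_all add: crossing_simps field_simps)
qed (use assms(3) in \<open>rule supported_scale\<close>)

lemma bent_map_kink_1:
  fixes t :: "'a::field_char_0"
  assumes "c k = (t, 1)" "t \<noteq> 0" "supported 3 f"
  shows "bent_map c [p, (k, k \<notin> S), q] (map (reverse_piece S) (kink 1 k)) f
       = (\<lambda>w. f w * t powi (-2))"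
proof (rule supported_eqI)
  show "supported 3 (bent_map c [p, (k, k \<notin> S), q] (map (reverse_piece S) (kink 1 k)) f)"
    using supported_bent_map[OF tangle_kink_1, where f = f] assms(3) by (simp add: numeral_3_eq_3)
  fix w :: "index list" assume "length w = 3"
  then obtain x y z where "w = [x, y, z]" by (auto simp: length_Suc_conv numeral_3_eq_3)
  then show "bent_map c [p, (k, k \<notin> S), q] (map (reverse_piece S) (kink 1 k)) f w = f w * t powi (-2)"
    using assms(1,2) by (cases "k \<in> S"; cases y) (simp_all add: crossing_simps field_simps)
qed (use assms(3) in \<open>rule supported_scale\<close>)

lemma tangle_replicate: "tangle l ps l \<Longrightarrow> tangle l (concat (replicate m ps)) l"
  using tangle_level_after[of l ps l] by (induction m) (auto simp: tangle_append)

lemma bent_map_replicate: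
  fixes s :: "'a::field_char_0"
  assumes "tangle l ps l"
    and "\<And>f. supported (length l) f \<Longrightarrow> bent_map c l ps f = (\<lambda>w. f w * s)"
    and "supported (length l) f"
  shows "bent_map c l (concat (replicate m ps)) f = (\<lambda>w. f w * s ^ m)"
  using assms(3)
proof (induction m arbitrary: f)
  case 0
  then show ?case by (simp add: bent_map_def)
next
  case (Suc m)
  then show ?case
    by (simp add: bent_map_append[OF assms(1)] assms(2) supported_scale mult.assoc)
qed

definition clasp :: "piece list" where
  "clasp = [Cross 0 False, Cross 0 False, Cap 1]"

lemma bent_map_clasp:
  fixes \<alpha> \<beta> :: "'a::field_char_0"
  assumes c: "c 0 = (\<alpha>, 1)" "c 1 = (\<beta>, 1)" and nz: "\<alpha> \<noteq> 0" "\<beta> \<noteq> 0"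
  shows "bent_map c [(0, o0), (1, o1), (1, \<not> o1)] clasp
           (\<lambda>w. bent_map c [(0, o0)] [Cup 1 (1, o1)] (bvec [i]) w * s) [j]
       = (if o0 = o1 then - (\<alpha>\<^sup>2 - \<alpha> powi (-2)) * \<alpha>\<^sup>2 * \<beta>\<^sup>2
          else (\<alpha>\<^sup>2 - \<alpha> powi (-2)) * \<alpha> powi (-2) * \<beta> powi (-2)) * s * bvec [i] [j]"
  using assms
  by (cases o0; cases o1; cases i; cases j)
     (simp_all add: clasp_def bvec_def crossing_simps field_simps power2_eq_square power4_eq_xxxx)

section \<open>Surgery diagrams of lens spaces\<close>

lemma lens_space_pieces:
  "map (reverse_piece S) (pieces (lens_space m n)) =
     concat (replicate m (map (reverse_piece S) (kink 0 0)))
     @ [Cup 1 (1, 1 \<notin> S)]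
     @ concat (replicate n (map (reverse_piece S) (kink 1 1))) @ clasp"
  by (simp add: lens_space_def clasp_def map_concat map_replicate reverse_strand_def opp_def)

lemma cut_map_lens_space:
  fixes \<alpha> \<beta> :: "'a::field_char_0"
  assumes c: "c 0 = (\<alpha>, 1)" "c 1 = (\<beta>, 1)" and nz: "\<alpha> \<noteq> 0" "\<beta> \<noteq> 0"
  shows "cut_map (reverse_components S (lens_space m n)) c (bvec [i]) =
    (\<lambda>w. (if (0 \<in> S) = (1 \<in> S) then - (\<alpha>\<^sup>2 - \<alpha> powi (-2)) * \<alpha>\<^sup>2 * \<beta>\<^sup>2
          else (\<alpha>\<^sup>2 - \<alpha> powi (-2)) * \<alpha> powi (-2) * \<beta> powi (-2))
         * ((\<alpha> powi (-2)) ^ m * (\<beta> powi (-2)) ^ n) * bvec [i] w)"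
proof -
  let ?s0 = "(0 :: nat, 0 \<notin> S)" and ?s1 = "(1 :: nat, 1 \<notin> S)" and ?s1' = "(1 :: nat, 1 \<in> S)"
  let ?A = "(\<alpha> powi (-2)) ^ m" and ?B = "(\<beta> powi (-2)) ^ n"
  let ?K0 = "concat (replicate m (map (reverse_piece S) (kink 0 0)))"
  let ?K1 = "concat (replicate n (map (reverse_piece S) (kink 1 1)))"
  let ?g = "bent_map c [?s0] [Cup 1 ?s1] (bvec [i])"
  have K0: "tangle [?s0] ?K0 [?s0]" by (intro tangle_replicate tangle_kink_0)
  have cup: "tangle [?s0] [Cup 1 ?s1] [?s0, ?s1, ?s1']" by (simp add: opp_def)
  have K1: "tangle [?s0, ?s1, ?s1'] ?K1 [?s0, ?s1, ?s1']" by (intro tangle_replicate tangle_kink_1)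
  have clasp: "tangle [?s0, ?s1, ?s1'] clasp [?s0]" by (simp add: clasp_def opp_def)
  have sup: "supported 1 (bvec [i] :: 'a tensor)" by (auto simp: supported_def bvec_def)
  have supg: "supported 3 ?g" using supported_bent_map[OF cup, where f = "bvec [i]"] sup
    by (simp add: numeral_3_eq_3)
  have 1: "bent_map c [?s0] ?K0 (bvec [i]) = (\<lambda>w. bvec [i] w * ?A)"
    by (rule bent_map_replicate[OF tangle_kink_0])
       (use bent_map_kink_0[where c = c and k = 0 and t = \<alpha>] c nz sup in auto)
  have 2: "bent_map c [?s0] [Cup 1 ?s1] (\<lambda>w. bvec [i] w * ?A) = (\<lambda>w. ?g w * ?A)"
    by (simp add: bent_map_def apply_at_0 fun_eq_iff mult_ac)
  have 3: "bent_map c [?s0, ?s1, ?s1'] ?K1 (\<lambda>w. ?g w * ?A) = (\<lambda>w. ?g w * (?A * ?B))"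
  proof -
    have "bent_map c [?s0, ?s1, ?s1'] ?K1 (\<lambda>w. ?g w * ?A) = (\<lambda>w. (?g w * ?A) * ?B)"
      by (rule bent_map_replicate[OF tangle_kink_1])
         (use bent_map_kink_1[where c = c and k = 1 and t = \<beta>] c nz
            supported_scale[OF supg] in \<open>auto simp: numeral_3_eq_3\<close>)
    then show ?thesis by (simp add: mult.assoc)
  qed
  have "cut_map (reverse_components S (lens_space m n)) c (bvec [i])
      = bent_map c [?s0] (?K0 @ [Cup 1 ?s1] @ ?K1 @ clasp) (bvec [i])"
    unfolding lens_space_pieces[symmetric]
    by (simp add: cut_map_def bent_map_def reverse_components_def lens_space_def reverse_strand_def opp_def)
  also have "\<dots> = bent_map c [?s0, ?s1, ?s1'] clasp (\<lambda>w. ?g w * (?A * ?B))"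
    unfolding bent_map_append[OF K0] 1 bent_map_append[OF cup] 2 bent_map_append[OF K1] 3 ..
  also have "\<dots> = (\<lambda>w. (if (0 \<in> S) = (1 \<in> S) then - (\<alpha>\<^sup>2 - \<alpha> powi (-2)) * \<alpha>\<^sup>2 * \<beta>\<^sup>2
          else (\<alpha>\<^sup>2 - \<alpha> powi (-2)) * \<alpha> powi (-2) * \<beta> powi (-2)) * (?A * ?B) * bvec [i] w)"
  proof (rule supported_eqI)
    show "supported 1 (bent_map c [?s0, ?s1, ?s1'] clasp (\<lambda>w. ?g w * (?A * ?B)))"
      using supported_bent_map[OF clasp, where f = "\<lambda>w. ?g w * (?A * ?B)"] supported_scale[OF supg]
      by (simp add: numeral_3_eq_3)
    fix w :: "index list" assume "length w = 1"
    then obtain j where w: "w = [j]" by (auto simp: length_Suc_conv)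
    show "bent_map c [?s0, ?s1, ?s1'] clasp (\<lambda>w. ?g w * (?A * ?B)) w
        = (if (0 \<in> S) = (1 \<in> S) then - (\<alpha>\<^sup>2 - \<alpha> powi (-2)) * \<alpha>\<^sup>2 * \<beta>\<^sup>2
          else (\<alpha>\<^sup>2 - \<alpha> powi (-2)) * \<alpha> powi (-2) * \<beta> powi (-2)) * (?A * ?B) * bvec [i] w"
      using bent_map_clasp[where c = c and ?o0.0 = "0 \<notin> S" and ?o1.0 = "1 \<notin> S" and i = i and j = j
          and s = "?A * ?B", OF c nz]
      unfolding w by (simp only: not_not not_iff) auto
  qed (auto simp: supported_def bvec_def)
  finally show ?thesis .
qed

lemma Alexander_lens_space:
  fixes \<alpha> \<beta> :: "'a::field_char_0"
  assumes c: "c 0 = (\<alpha>, 1)" "c 1 = (\<beta>, 1)" and nz: "\<alpha> \<noteq> 0" "\<beta> \<noteq> 0" and "\<alpha> ^ 4 \<noteq> 1"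
  shows "Alexander (reverse_components S (lens_space m n)) c =
    (if (0 \<in> S) = (1 \<in> S) then - (\<alpha>\<^sup>2 * \<beta>\<^sup>2) else 1 / (\<alpha>\<^sup>2 * \<beta>\<^sup>2)) / ((\<alpha> ^ m)\<^sup>2 * (\<beta> ^ n)\<^sup>2)"
proof -
  define s where "s = (if (0 \<in> S) = (1 \<in> S) then - (\<alpha>\<^sup>2 - \<alpha> powi (-2)) * \<alpha>\<^sup>2 * \<beta>\<^sup>2
          else (\<alpha>\<^sup>2 - \<alpha> powi (-2)) * \<alpha> powi (-2) * \<beta> powi (-2))
         * ((\<alpha> powi (-2)) ^ m * (\<beta> powi (-2)) ^ n)"
  have s: "cut_map (reverse_components S (lens_space m n)) c (bvec [i]) = (\<lambda>w. s * bvec [i] w)" for i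
    unfolding s_def by (rule cut_map_lens_space[OF c nz])
  have "(THE s. \<forall>i. cut_map (reverse_components S (lens_space m n)) c (bvec [i])
        = (\<lambda>w. s * bvec [i] w)) = s"
  proof (rule the_equality)
    fix s' assume "\<forall>i. cut_map (reverse_components S (lens_space m n)) c (bvec [i]) = (\<lambda>w. s' * bvec [i] w)"
    then have "cut_map (reverse_components S (lens_space m n)) c (bvec [E0]) = (\<lambda>w. s' * bvec [E0] w)"
      by blast
    from fun_cong[OF this, of "[E0]"] show "s' = s" unfolding s by (simp add: bvec_def)
  qed (simp add: s)
  moreover have "fst (c (fst (cut_strand (reverse_components S (lens_space m n))))) = \<alpha>"
    using c by (simp add: reverse_components_def lens_space_def reverse_strand_def opp_def)
  ultimately have A: "Alexander (reverse_components S (lens_space m n)) c = s * dfac \<alpha>"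
    by (simp add: Alexander_def)
  have "\<alpha>\<^sup>2 - \<alpha> powi (-2) \<noteq> 0"
    using nz assms(5) by (auto simp: power_int_minus field_simps power2_eq_square power4_eq_xxxx)
  then have d: "(\<alpha>\<^sup>2 - \<alpha> powi (-2)) * dfac \<alpha> = 1" by (simp add: dfac_def)
  have "s * dfac \<alpha> = (if (0 \<in> S) = (1 \<in> S) then - (\<alpha>\<^sup>2 * \<beta>\<^sup>2) else \<alpha> powi (-2) * \<beta> powi (-2))
      * ((\<alpha> powi (-2)) ^ m * (\<beta> powi (-2)) ^ n) * ((\<alpha>\<^sup>2 - \<alpha> powi (-2)) * dfac \<alpha>)"
    unfolding s_def by (simp add: algebra_simps)
  moreover have "x powi (-2) = 1 / x\<^sup>2" "(x powi (-2)) ^ k = 1 / (x ^ k)\<^sup>2" for x :: 'a and k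
    by (simp_all add: power_int_minus divide_inverse power_inverse mult.commute flip: power_mult)
  ultimately show ?thesis
    unfolding A d by simp
qed

lemma Kirby_Alexander_lens_space:
  fixes a b :: "'a::field_char_0"
  assumes c: "c 0 = (a, 1)" "c 1 = (b, 1)" and nz: "a \<noteq> 0" "b \<noteq> 0" and a4: "a ^ 4 \<noteq> 1"
    and rel: "a ^ m = b" "b ^ n = a"
  shows "Kirby_Alexander (lens_space m n) c = - 4 * dfac a * dfac b"
proof -
  have comps: "components (lens_space m n) = 2" by (simp add: lens_space_def)
  have two: "{..<2::nat} = {0, 1}" by auto
  have Pow: "Pow {..<2::nat} = {{}, {0}, {1}, {0, 1}}" unfolding two by (simp add: Pow_insert insert_commute)
  have a4': "inverse a ^ 4 \<noteq> 1" using a4 by (simp add: power_inverse)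
  let ?c = "\<lambda>S k. if k \<in> S then (inverse (fst (c k)), 2 - snd (c k)) else c k"
  have "Alexander (reverse_components {} (lens_space m n)) (?c {}) = -1"
    by (subst Alexander_lens_space[of _ a b]) (use c nz a4 rel in auto)
  moreover have "Alexander (reverse_components {0} (lens_space m n)) (?c {0}) = 1"
    by (subst Alexander_lens_space[of _ "inverse a" b])
       (use c nz a4' rel in \<open>auto simp: power_inverse field_simps\<close>)
  moreover have "Alexander (reverse_components {1} (lens_space m n)) (?c {1}) = 1"
    by (subst Alexander_lens_space[of _ a "inverse b"])
       (use c nz a4 rel in \<open>auto simp: power_inverse field_simps\<close>)
  moreover have "Alexander (reverse_components {0, 1} (lens_space m n)) (?c {0, 1}) = -1"
    by (subst Alexander_lens_space[of _ "inverse a" "inverse b"])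
       (use c nz a4' rel in \<open>auto simp: power_inverse field_simps\<close>)
  ultimately show ?thesis
    unfolding Kirby_Alexander_def comps Pow using c by (simp add: two)
qed

lemma arc_joins_kinks_0:
  "arc_joins [x] (Suc x) (concat (replicate m (kink 0 k)) @ qs) =
     {(i, Suc i) | i. x \<le> i \<and> i < x + m} \<union> arc_joins [x + m] (Suc (x + m)) qs"
proof (induction m arbitrary: x)
  case (Suc m)
  have "{(i, Suc i) | i. x \<le> i \<and> i < x + Suc m} = insert (x, Suc x) {(i, Suc i) | i. Suc x \<le> i \<and> i < Suc x + m}"
    by (auto simp: le_eq_less_or_eq)
  then show ?case using Suc[of "Suc x"] by (simp add: kink_def)
qed auto

lemma arc_joins_kinks_1:
  "arc_joins [p, x, q] (Suc x) (concat (replicate n (kink 1 k)) @ qs) =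
     {(i, Suc i) | i. x \<le> i \<and> i < x + n} \<union> arc_joins [p, x + n, q] (Suc (x + n)) qs"
proof (induction n arbitrary: x)
  case (Suc n)
  have "{(i, Suc i) | i. x \<le> i \<and> i < x + Suc n} = insert (x, Suc x) {(i, Suc i) | i. Suc x \<le> i \<and> i < Suc x + n}"
    by (auto simp: le_eq_less_or_eq)
  then show ?case using Suc[of "Suc x"] by (simp add: kink_def numeral_eq_Suc)
qed auto

lemma rtrancl_interval:
  assumes "\<And>i. p \<le> i \<Longrightarrow> i < q \<Longrightarrow> (i, Suc i) \<in> R"
    and "p \<le> a" "a \<le> q" "p \<le> b" "b \<le> q"
  shows "(a, b) \<in> (R \<union> R\<inverse>)\<^sup>*"
proof -
  have up: "(a, b) \<in> (R \<union> R\<inverse>)\<^sup>*" if "p \<le> a" "a \<le> b" "b \<le> q" for a b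
    using that(2,3)
  proof (induction b rule: dec_induct)
    case (step k)
    then have "(k, Suc k) \<in> R \<union> R\<inverse>" using assms(1) that(1) by simp
    with step show ?case by (auto intro: rtrancl.rtrancl_into_rtrancl)
  qed simp
  have "sym ((R \<union> R\<inverse>)\<^sup>*)" by (intro sym_rtrancl sym_Un_converse)
  then show ?thesis using up[of a b] up[of b a] assms(2-5) by (cases "a \<le> b") (auto dest: symD)
qed

lemma cup_components_append: "cup_components (ps @ qs) = cup_components ps @ cup_components qs"
  by (induction ps rule: cup_components.induct) auto

lemma cup_components_kinks: "cup_components (concat (replicate m (kink i k))) = replicate m k"
  by (induction m) (simp_all add: cup_components_append kink_def)

lemma tangle_lens_space: "tangle [(0, True)] (pieces (lens_space m n)) [(0, True)]"
proof -
  have *: "reverse_piece {} = id"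
  proof
    fix p show "reverse_piece {} p = id p" by (cases p) (simp_all add: reverse_strand_def)
  qed
  have K0: "tangle [(0, True)] (concat (replicate m (kink 0 0))) [(0, True)]"
    using tangle_replicate[OF tangle_kink_0[of 0 "{}"]] by (simp add: *)
  have K1: "tangle [(0, True), (1, True), (1, False)] (concat (replicate n (kink 1 1)))
      [(0, True), (1, True), (1, False)]"
    using tangle_replicate[OF tangle_kink_1[of _ 1 "{}"]] by (simp add: *)
  have "tangle [(0, True)] [Cup 1 (1, True)] [(0, True), (1, True), (1, False)]"
    and "tangle [(0, True), (1, True), (1, False)] [Cross 0 False, Cross 0 False, Cap 1] [(0, True)]"
    by (simp_all add: opp_def)
  then show ?thesis
    unfolding lens_space_def cut_link.sel by (intro tangle_trans[OF K0] tangle_trans[OF _ tangle_trans[OF K1]])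
qed

lemma link_diagram_lens_space: "link_diagram (lens_space m n)"
proof -
  let ?D = "lens_space m n"
  have arcs: "fst (cut_strand ?D) # cup_components (pieces ?D) = replicate (Suc m) 0 @ replicate (Suc n) 1"
    by (simp add: lens_space_def cup_components_append cup_components_kinks)
  define J where "J = arc_joins [0] 1 (pieces ?D)"
  have J: "J = {(i, Suc i) | i. i < m} \<union> {(i, Suc i) | i. Suc m \<le> i \<and> i < Suc m + n}
      \<union> {(Suc m + n, Suc m)}"
    using arc_joins_kinks_0[of 0 m 0] arc_joins_kinks_1[of m "Suc m" "Suc m" n 1]
    by (simp add: J_def lens_space_def Un_assoc)
  have "(a, b) \<in> (J \<union> J\<inverse>)\<^sup>*"
    if less: "a < Suc m + Suc n" "b < Suc m + Suc n"
      and eq: "(replicate (Suc m) 0 @ replicate (Suc n) (1::nat)) ! a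
         = (replicate (Suc m) 0 @ replicate (Suc n) 1) ! b" for a b
  proof -
    have nth: "(replicate (Suc m) 0 @ replicate (Suc n) (1::nat)) ! x = (if x < Suc m then 0 else 1)"
      if "x < Suc m + Suc n" for x
      using that by (simp add: nth_append del: replicate_Suc)
    consider "a \<le> m" "b \<le> m" | "Suc m \<le> a" "Suc m \<le> b"
      using eq[unfolded nth[OF less(1)] nth[OF less(2)]] by (auto split: if_splits simp: not_less)
    then show ?thesis
    proof cases
      case 1
      then show ?thesis by (intro rtrancl_interval[of 0 m]) (auto simp: J)
    next
      case 2
      then show ?thesis using less by (intro rtrancl_interval[of "Suc m" "Suc m + n"]) (auto simp: J)
    qed
  qed
  moreover have "tangle [cut_strand ?D] (pieces ?D) [cut_strand ?D]"
    using tangle_lens_space by (simp add: lens_space_def)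
  moreover have "set (replicate (Suc m) 0 @ replicate (Suc n) 1) = {..<components ?D}"
    by (auto simp: lens_space_def)
  ultimately show ?thesis
    unfolding link_diagram_def Let_def arcs J_def by (simp del: replicate_Suc)
qed

lemma sign_sum_append: "sign_sum j k l (ps @ qs) = sign_sum j k l ps + sign_sum j k (level_after l ps) qs"
proof (induction ps arbitrary: l)
  case (Cons p ps)
  then show ?case by (cases p) auto
qed simp

lemma sign_sum_replicate:
  assumes "level_after l ps = l"
  shows "level_after l (concat (replicate m ps)) = l"
    and "sign_sum j k l (concat (replicate m ps)) = int m * sign_sum j k l ps"
proof -
  show *: "level_after l (concat (replicate m ps)) = l" for m by (induction m) (simp_all add: assms)
  show "sign_sum j k l (concat (replicate m ps)) = int m * sign_sum j k l ps"
    by (induction m) (simp_all add: sign_sum_append assms algebra_simps)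
qed

lemma linking_lens_space:
  "linking (lens_space m n) 0 0 = int m" "linking (lens_space m n) 1 1 = int n"
  "linking (lens_space m n) 0 1 = -1" "linking (lens_space m n) 1 0 = -1"
proof -
  have l0: "level_after [(0, True)] (kink 0 0) = [(0, True)]"
    and l1: "level_after [(0, True), (1, True), (1, False)] (kink 1 1) = [(0, True), (1, True), (1, False)]"
    by (simp_all add: kink_def opp_def)
  have cup: "level_after [(0, True)] [Cup 1 (1, True)] = [(0, True), (1, True), (1, False)]"
    by (simp add: opp_def)
  have "sign_sum j k [(0, True)] (pieces (lens_space m n)) =
      int m * sign_sum j k [(0, True)] (kink 0 0) + (sign_sum j k [(0, True)] [Cup 1 (1, True)]
      + (int n * sign_sum j k [(0, True), (1, True), (1, False)] (kink 1 1)
      + sign_sum j k [(0, True), (1, True), (1, False)] [Cross 0 False, Cross 0 False, Cap 1]))" for j k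
    unfolding lens_space_def cut_link.sel sign_sum_append sign_sum_replicate[OF l0] cup
      sign_sum_replicate[OF l1] ..
  then have "sign_sum j k [(0, True)] (pieces (lens_space m n)) =
      (if {0} = {j, k} then int m else 0) + (if {1} = {j, k} then int n else 0)
      - (if {0, 1} = {j, k} then 2 else 0)" for j k
    by (simp add: kink_def opp_def crossing_sign_def insert_commute)
  then have "sign_sum j k [cut_strand (lens_space m n)] (pieces (lens_space m n)) =
      (if {0} = {j, k} then int m else 0) + (if {1} = {j, k} then int n else 0)
      - (if {0, 1} = {j, k} then 2 else 0)" for j k
    by (simp add: lens_space_def)
  then show "linking (lens_space m n) 0 0 = int m" "linking (lens_space m n) 1 1 = int n"
    "linking (lens_space m n) 0 1 = -1" "linking (lens_space m n) 1 0 = -1"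
    by (simp_all add: linking_def doubleton_eq_iff)
qed

section \<open>The palette\<close>

lemma field_units_eq:
  "field_units B = Multiplicative_Group.mult_of (ring_of_type_algebra\<lparr>carrier := B\<rparr>)"
  by (simp add: field_units_def Ring_Divisibility.mult_of_def Multiplicative_Group.mult_of_def)

lemma field_units_simps [simp]:
  "carrier (field_units B) = B - {0}"
  "x \<otimes>\<^bsub>field_units B\<^esub> y = x * y"
  "\<one>\<^bsub>field_units B\<^esub> = 1"
  by (simp_all add: field_units_eq ring_of_type_algebra_def)

lemma palette_group_simps [simp]:
  "carrier (palette_group B G) = G"
  "x \<otimes>\<^bsub>palette_group B G\<^esub> y = x * y"
  "\<one>\<^bsub>palette_group B G\<^esub> = 1"
  by (simp_all add: palette_group_def)

lemma group_field_units:
  assumes "subfield B ring_of_type_algebra"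
  shows "group (field_units B)"
  unfolding field_units_eq
  using ring.subfield_iff(2)[OF ring_from_type_algebra assms]
  by (rule Multiplicative_Group.field.field_mult_group)

lemma inv_field_units:
  assumes "subfield B ring_of_type_algebra" "x \<in> B" "x \<noteq> 0"
  shows "inv\<^bsub>field_units B\<^esub> x = inverse x"
proof -
  interpret group "field_units B" using assms(1) by (rule group_field_units)
  have "inv\<^bsub>field_units B\<^esub> x * x = 1"
    using l_inv[of x] assms by simp
  then show ?thesis using assms(3) by (simp add: field_simps)
qed

lemma group_palette_group: "one_palette B G \<Longrightarrow> group (palette_group B G)"
  unfolding palette_group_def one_palette_def
  by (auto intro: group.subgroup_imp_group group_field_units)

lemma not_contains_copy_Z2:
  assumes "group A" "\<And>x. x \<in> carrier A \<Longrightarrow> x \<otimes>\<^bsub>A\<^esub> x = \<one>\<^bsub>A\<^esub> \<Longrightarrow> x = \<one>\<^bsub>A\<^esub>"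
  shows "\<not> contains_copy A (integer_mod_group 2)"
proof
  assume "contains_copy A (integer_mod_group 2)"
  then obtain H h where H: "subgroup H A" and h: "h \<in> iso (A\<lparr>carrier := H\<rparr>) (integer_mod_group 2)"
    by (auto simp: contains_copy_def is_iso_def)
  have bij: "bij_betw h H {0, 1}"
  proof -
    have "{0..<2} = {0, 1 :: int}" by auto
    then show ?thesis using h by (simp add: iso_def carrier_integer_mod_group)
  qed
  have mult: "h (x \<otimes>\<^bsub>A\<^esub> y) = (h x + h y) mod 2" if "x \<in> H" "y \<in> H" for x y
    using h that by (auto simp: iso_def hom_def)
  have "x = \<one>\<^bsub>A\<^esub>" if x: "x \<in> H" for x
  proof (rule assms(2))
    show "x \<in> carrier A" using subgroup.subset[OF H] x by blast
    have one: "\<one>\<^bsub>A\<^esub> \<in> H" using H by (rule subgroup.one_closed)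
    have "\<one>\<^bsub>A\<^esub> \<otimes>\<^bsub>A\<^esub> \<one>\<^bsub>A\<^esub> = \<one>\<^bsub>A\<^esub>" using assms(1) by (simp add: group.is_monoid)
    then have "h \<one>\<^bsub>A\<^esub> = (h \<one>\<^bsub>A\<^esub> + h \<one>\<^bsub>A\<^esub>) mod 2" using mult[OF one one] by simp
    moreover have "h \<one>\<^bsub>A\<^esub> \<in> {0, 1}" "h x \<in> {0, 1}" using bij one x by (meson bij_betwE)+
    ultimately have "h (x \<otimes>\<^bsub>A\<^esub> x) = h \<one>\<^bsub>A\<^esub>" using mult[OF x x] by auto
    moreover have "x \<otimes>\<^bsub>A\<^esub> x \<in> H" using H x by (simp add: subgroup.m_closed)
    ultimately show "x \<otimes>\<^bsub>A\<^esub> x = \<one>\<^bsub>A\<^esub>"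
      using bij one by (auto simp: bij_betw_def inj_on_def)
  qed
  then have "h ` H \<subseteq> {h \<one>\<^bsub>A\<^esub>}" by auto
  then have "{0, 1} \<subseteq> {h \<one>\<^bsub>A\<^esub>}" using bij unfolding bij_betw_def by blast
  then show False by auto
qed

context
  fixes \<xi> :: complex and B G :: "complex set"
  assumes \<xi>: "\<xi> = exp (2 * complex_of_real pi * \<i> / 7)"
    and B: "B = generate_field ring_of_type_algebra {complex_of_real pi, \<xi>}"
    and G: "G = generate (field_units B) {complex_of_real pi, \<xi>}"
begin

lemma root_eq_cis: "\<xi> ^ k = cis (2 * pi * real k / 7)"
  unfolding \<xi> exp_of_nat_mult[symmetric] cis_conv_exp by (simp add: mult_ac)

lemma root_power_7: "\<xi> ^ 7 = 1"
  unfolding root_eq_cis by simp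

lemma root_nonzero: "\<xi> \<noteq> 0"
  unfolding \<xi> by simp

lemma subfield_B: "subfield B ring_of_type_algebra"
  unfolding B
  by (rule field.generate_field_is_subfield[OF field_from_type_algebra])
     (simp add: ring_of_type_algebra_def)

lemma generators_in_units: "{complex_of_real pi, \<xi>} \<subseteq> carrier (field_units B)"
  unfolding B using root_nonzero by (auto intro: generate_field.incl)

lemma one_palette_BG: "one_palette B G"
  unfolding one_palette_def G
  using subfield_B group.generate_is_subgroup[OF group_field_units generators_in_units] by blast

lemma generators_in_G: "complex_of_real pi \<in> G" "\<xi> \<in> G"
  unfolding G by (auto intro: generate.incl)

lemma G_elem: "x \<in> G \<Longrightarrow> \<exists>k l::int. x = complex_of_real pi powi k * \<xi> powi l"
  unfolding G
proof (induction rule: generate.induct)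
  case one
  show ?case by (rule exI[of _ 0], rule exI[of _ 0]) simp
next
  case (incl h)
  have "h = complex_of_real pi powi 1 * \<xi> powi 0 \<or> h = complex_of_real pi powi 0 * \<xi> powi 1"
    using incl by auto
  then show ?case by blast
next
  case (inv h)
  then have "inv\<^bsub>field_units B\<^esub> h = inverse h"
    using generators_in_units by (intro inv_field_units subfield_B) auto
  then have "inv\<^bsub>field_units B\<^esub> h = complex_of_real pi powi (-1) * \<xi> powi 0
      \<or> inv\<^bsub>field_units B\<^esub> h = complex_of_real pi powi 0 * \<xi> powi (-1)"
    using inv by auto
  then show ?case by blast
next
  case (eng h1 h2)
  then obtain k l k' l' where "h1 = complex_of_real pi powi k * \<xi> powi l"
    "h2 = complex_of_real pi powi k' * \<xi> powi l'" by blast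
  then have "h1 * h2 = complex_of_real pi powi (k + k') * \<xi> powi (l + l')"
    using root_nonzero by (simp add: power_int_add)
  then show ?case by auto
qed

lemma norm_root: "norm \<xi> = 1"
  using root_eq_cis[of 1] by simp

lemma pi_powi_eq_1_iff: "pi powi k = 1 \<longleftrightarrow> k = 0"
proof
  assume *: "pi powi k = 1"
  have "1 < pi" using pi_ge_two by simp
  show "k = 0"
  proof (rule ccontr)
    assume "k \<noteq> 0"
    then consider "k > 0" | "k < 0" by linarith
    then show False
    proof cases
      case 1
      then show False using power_int_strict_increasing[of 0 k pi] * \<open>1 < pi\<close> by simp
    next
      case 2
      then show False using power_int_strict_increasing[of k 0 pi] * \<open>1 < pi\<close> by simp
    qed
  qed
qed simp

lemma no_involution:
  assumes "x \<in> G" "x * x = 1"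
  shows "x = 1"
proof -
  obtain k l where x: "x = complex_of_real pi powi k * \<xi> powi l"
    using G_elem[OF assms(1)] by blast
  have "norm x * norm x = 1" using assms(2) by (metis norm_mult norm_one)
  then have "norm x = 1" by (metis norm_ge_zero abs_of_nonneg real_sqrt_abs2 real_sqrt_one)
  then have "pi powi k = 1" by (simp add: x norm_mult norm_power_int norm_root)
  then have "x = \<xi> powi l" by (simp add: x pi_powi_eq_1_iff)
  then have "x ^ 7 = (\<xi> ^ 7) powi l"
    by (metis power_int_mult power_int_of_nat mult.commute)
  then have "x ^ 7 = 1" by (simp add: root_power_7)
  moreover have "x ^ 7 = (x * x) ^ 3 * x" by (simp add: power_numeral_reduce)
  ultimately show ?thesis using assms(2) by simp
qed

lemma contains_copy_Z: "contains_copy (palette_group B G) integer_group"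
  unfolding contains_copy_def
proof (intro exI conjI)
  interpret P: group "palette_group B G" using one_palette_BG by (rule group_palette_group)
  let ?p = "complex_of_real pi"
  let ?H = "range (\<lambda>k::int. ?p powi k)"
  have H: "?H = range (\<lambda>k::int. ?p [^]\<^bsub>palette_group B G\<^esub> k)"
    and hom: "(\<lambda>k::int. ?p [^]\<^bsub>palette_group B G\<^esub> k) = (\<lambda>k. ?p powi k)"
  proof -
    have n: "?p [^]\<^bsub>palette_group B G\<^esub> n = ?p ^ n" for n :: nat
      by (induction n) auto
    show *: "(\<lambda>k::int. ?p [^]\<^bsub>palette_group B G\<^esub> k) = (\<lambda>k. ?p powi k)"
    proof
      fix k :: int
      show "?p [^]\<^bsub>palette_group B G\<^esub> k = ?p powi k"
      proof (cases "k \<ge> 0")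
        case True
        then show ?thesis using n by (metis int_pow_int nonneg_int_cases power_int_of_nat)
      next
        case False
        have "(?p [^]\<^bsub>palette_group B G\<^esub> k) * (?p [^]\<^bsub>palette_group B G\<^esub> (-k)) = 1"
          using P.int_pow_mult[of ?p k "-k"] generators_in_G by simp
        moreover have "?p [^]\<^bsub>palette_group B G\<^esub> (-k) = ?p powi (-k)"
          using n False by (metis int_pow_int neg_0_le_iff_le nle_le nonneg_int_cases power_int_of_nat)
        ultimately show ?thesis by (simp add: power_int_minus field_simps)
      qed
    qed
    then show "?H = range (\<lambda>k::int. ?p [^]\<^bsub>palette_group B G\<^esub> k)" by simp
  qed
  show sub: "subgroup ?H (palette_group B G)"
    unfolding H using P.subgroup_of_powers[of ?p] generators_in_G by simp
  have "(\<lambda>k. ?p powi k) \<in> iso integer_group ((palette_group B G)\<lparr>carrier := ?H\<rparr>)"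
  proof (rule isoI)
    show "(\<lambda>k. ?p powi k) \<in> hom integer_group ((palette_group B G)\<lparr>carrier := ?H\<rparr>)"
      by (auto simp: hom_def power_int_add)
    have "inj (\<lambda>k::int. ?p powi k)"
    proof (rule injI)
      fix k l :: int assume "?p powi k = ?p powi l"
      then have "?p powi (k - l) = 1" by (simp add: power_int_diff)
      then have "pi powi (k - l) = 1" by (metis of_real_1 of_real_eq_iff of_real_power_int)
      then show "k = l" by (simp add: pi_powi_eq_1_iff)
    qed
    then show "bij_betw (\<lambda>k. ?p powi k) (carrier integer_group)
        (carrier ((palette_group B G)\<lparr>carrier := ?H\<rparr>))"
      by (simp add: bij_betw_def)
  qed
  then show "(palette_group B G)\<lparr>carrier := ?H\<rparr> \<cong> integer_group"
    by (meson group.iso_sym group_integer_group is_isoI)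
qed

lemma manifold_palette_BG: "manifold_palette B G"
  unfolding manifold_palette_def
proof (intro conjI)
  show "\<exists>S. finite S \<and> S \<subseteq> G \<and> generate (field_units B) S = G"
    using generators_in_G G by (intro exI[of _ "{complex_of_real pi, \<xi>}"]) simp
  show "\<not> contains_copy (palette_group B G) (integer_mod_group 2)"
    using group_palette_group[OF one_palette_BG] no_involution
    by (intro not_contains_copy_Z2) auto
qed (rule one_palette_BG contains_copy_Z)+

end

section \<open>Cohomology classes of lens spaces\<close>

lemma components_lens_space [simp]: "components (lens_space m n) = 2"
  by (simp add: lens_space_def)

lemma surgery_relation_lens_space:
  "surgery_relation (lens_space m n) 0 = frag_cmul (int m) (frag_of 0) - frag_of 1"
  "surgery_relation (lens_space m n) 1 = frag_cmul (int n) (frag_of 1) - frag_of 0"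
proof -
  have "{..<2::nat} = {0, 1}" by auto
  then show "surgery_relation (lens_space m n) 0 = frag_cmul (int m) (frag_of 0) - frag_of 1"
    "surgery_relation (lens_space m n) 1 = frag_cmul (int n) (frag_of 1) - frag_of 0"
    using linking_lens_space[of m n] by (simp_all add: surgery_relation_def)
qed

lemma surgery_relation_in_carrier:
  "surgery_relation D k \<in> carrier (free_Abelian_group {..<components D})"
  unfolding surgery_relation_def
  by (intro sum_closed_free_Abelian_group) (use keys_cmul in force)

lemma subgroup_surgery_relations: "subgroup (surgery_relations D) (free_Abelian_group {..<components D})"
  unfolding surgery_relations_def
  by (intro group.generate_is_subgroup) (use surgery_relation_in_carrier in auto)

lemma normal_surgery_relations: "surgery_relations D \<lhd> free_Abelian_group {..<components D}"
  by (intro comm_group.subgroup_imp_normal abelian_free_Abelian_group subgroup_surgery_relations)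

lemma palette_nonzero: "one_palette B G \<Longrightarrow> x \<in> G \<Longrightarrow> x \<noteq> 0"
  using subgroup.subset[of G "field_units B"] by (auto simp: one_palette_def)

context
  fixes B G :: "'a::field_char_0 set" and S :: "nat set" and \<phi> :: "(nat \<Rightarrow>\<^sub>0 int) \<Rightarrow> 'a"
  assumes palette: "one_palette B G"
    and hom: "\<phi> \<in> hom (free_Abelian_group S) (palette_group B G)"
begin

lemma hom_nonzero: "Poly_Mapping.keys x \<subseteq> S \<Longrightarrow> \<phi> x \<noteq> 0"
  using hom_in_carrier[OF hom, of x] palette_nonzero[OF palette] by simp

lemma hom_add: "Poly_Mapping.keys x \<subseteq> S \<Longrightarrow> Poly_Mapping.keys y \<subseteq> S \<Longrightarrow> \<phi> (x + y) = \<phi> x * \<phi> y"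
  using hom_mult[OF hom, of x y] by simp

lemma hom_zero: "\<phi> 0 = 1"
  using hom_add[of 0 0] hom_nonzero[of 0] by simp

lemma hom_diff:
  assumes "Poly_Mapping.keys x \<subseteq> S" "Poly_Mapping.keys y \<subseteq> S"
  shows "\<phi> (x - y) = \<phi> x / \<phi> y"
proof -
  have "Poly_Mapping.keys (x - y) \<subseteq> S" using keys_diff[of x y] assms by blast
  then have "\<phi> (x - y) * \<phi> y = \<phi> x" using hom_add[of "x - y" y] assms(2) by simp
  then show ?thesis using hom_nonzero[OF assms(2)] by (metis nonzero_mult_div_cancel_right)
qed

lemma hom_frag_cmul:
  assumes "Poly_Mapping.keys x \<subseteq> S"
  shows "\<phi> (frag_cmul (int n) x) = \<phi> x ^ n"
proof (induction n)
  case (Suc n)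
  have "frag_cmul (int (Suc n)) x = x + frag_cmul (int n) x"
    using frag_cmul_distrib[of 1 "int n" x] by simp
  moreover have "Poly_Mapping.keys (frag_cmul (int n) x) \<subseteq> S" using keys_cmul assms by (rule order_trans)
  ultimately have "\<phi> (frag_cmul (int (Suc n)) x) = \<phi> x * \<phi> (frag_cmul (int n) x)"
    using hom_add[OF assms] by simp
  then show ?case using Suc by simp
qed (simp add: hom_zero)

lemma hom_eq_1:
  assumes "\<And>k. k \<in> S \<Longrightarrow> \<phi> (frag_of k) = 1" "Poly_Mapping.keys x \<subseteq> S"
  shows "\<phi> x = 1"
proof (rule free_Abelian_group_induct[OF assms(2), where P = "\<lambda>x. \<phi> x = 1"])
  fix x y assume "Poly_Mapping.keys x \<subseteq> S" "Poly_Mapping.keys y \<subseteq> S" "\<phi> x = 1" "\<phi> y = 1"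
  then show "\<phi> (x - y) = 1" using hom_diff[of x y] by simp
qed (rule hom_zero, rule assms(1))

end

lemma hom_surgery_relation:
  fixes B G :: "'a::field_char_0 set"
  assumes "one_palette B G" "\<phi> \<in> hom (free_Abelian_group {..<2}) (palette_group B G)"
  shows "\<phi> (surgery_relation (lens_space m n) 0) = \<phi> (frag_of 0) ^ m / \<phi> (frag_of 1)"
    "\<phi> (surgery_relation (lens_space m n) 1) = \<phi> (frag_of 1) ^ n / \<phi> (frag_of 0)"
proof -
  have "Poly_Mapping.keys (frag_cmul c (frag_of k)) \<subseteq> {..<2}" if "k < 2" for c and k :: nat
    using keys_cmul[of c "frag_of k"] that by auto
  then show "\<phi> (surgery_relation (lens_space m n) 0) = \<phi> (frag_of 0) ^ m / \<phi> (frag_of 1)"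
    "\<phi> (surgery_relation (lens_space m n) 1) = \<phi> (frag_of 1) ^ n / \<phi> (frag_of 0)"
    by (simp_all add: surgery_relation_lens_space hom_diff[OF assms] hom_frag_cmul[OF assms]
        del: single_one One_nat_def)
qed

lemma cohomology_class_meridians:
  fixes B G :: "'a::field_char_0 set"
  assumes pal: "one_palette B G" and \<omega>: "nontrivial_class B G (lens_space m n) \<omega>"
  defines "a \<equiv> \<omega> (meridian (lens_space m n) 0)" and "b \<equiv> \<omega> (meridian (lens_space m n) 1)"
  shows "a \<in> G" "b \<in> G" "a ^ m = b" "b ^ n = a" "a \<noteq> 1" "b \<noteq> 1"
proof -
  let ?F = "free_Abelian_group {..<2::nat}" and ?N = "surgery_relations (lens_space m n)"
  define \<phi> where "\<phi> = (\<lambda>x. \<omega> (?N #>\<^bsub>?F\<^esub> x))"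
  have N: "subgroup ?N ?F" "?N \<lhd> ?F"
    using subgroup_surgery_relations normal_surgery_relations by (metis components_lens_space)+
  have "\<omega> \<in> hom (?F Mod ?N) (palette_group B G)"
    using \<omega> by (simp add: nontrivial_class_def H1_def)
  then have hom: "\<phi> \<in> hom ?F (palette_group B G)"
    using hom_compose[OF normal.r_coset_hom_Mod[OF N(2)]] by (simp add: \<phi>_def comp_def)
  have ab: "a = \<phi> (frag_of 0)" "b = \<phi> (frag_of 1)"
    by (simp_all add: a_def b_def \<phi>_def meridian_def)
  show G: "a \<in> G" "b \<in> G" using hom_in_carrier[OF hom] by (simp_all add: ab)
  have "\<phi> (surgery_relation (lens_space m n) k) = 1" if "k < 2" for k
  proof -
    have "surgery_relation (lens_space m n) k \<in> ?N"
      unfolding surgery_relations_def using that by (auto intro: generate.incl)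
    then have "?N #>\<^bsub>?F\<^esub> surgery_relation (lens_space m n) k = ?N #>\<^bsub>?F\<^esub> 0"
      using N(1) subgroup.subset[OF N(1)] subgroup.one_closed[OF N(1)]
      by (metis group.coset_join2 group_free_Abelian_group one_free_Abelian_group subsetD)
    then show ?thesis using hom_zero[OF pal hom] by (simp add: \<phi>_def)
  qed
  from this[of 0] this[of 1] show rel: "a ^ m = b" "b ^ n = a"
    using G palette_nonzero[OF pal]
    by (auto simp: hom_surgery_relation[OF pal hom] ab simp del: single_one One_nat_def)
  have "\<not> (a = 1 \<and> b = 1)"
  proof
    assume "a = 1 \<and> b = 1"
    then have "\<phi> (frag_of k) = 1" if "k \<in> {..<2}" for k
      using that by (auto simp: ab numeral_2_eq_2 less_Suc_eq)
    then have "\<phi> x = 1" if "Poly_Mapping.keys x \<subseteq> {..<2}" for x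
      using hom_eq_1[OF pal hom _ that] by blast
    moreover obtain Y where "Y \<in> carrier (?F Mod ?N)" "\<omega> Y \<noteq> 1"
      using \<omega> by (auto simp: nontrivial_class_def H1_def)
    ultimately show False by (auto simp: carrier_FactGroup \<phi>_def)
  qed
  then show "a \<noteq> 1" "b \<noteq> 1" using rel by auto
qed

lemma cohomology_class_exists:
  fixes B G :: "'a::field_char_0 set"
  assumes pal: "one_palette B G" and G: "a \<in> G" "b \<in> G" and rel: "a ^ m = b" "b ^ n = a" and "a \<noteq> 1"
  obtains \<omega> where "nontrivial_class B G (lens_space m n) \<omega>" "\<omega> (meridian (lens_space m n) 0) = a"
proof -
  let ?F = "free_Abelian_group {..<2::nat}" and ?N = "surgery_relations (lens_space m n)"
  let ?P = "palette_group B G"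
  have N: "subgroup ?N ?F" "?N \<lhd> ?F"
    using subgroup_surgery_relations normal_surgery_relations by (metis components_lens_space)+
  have "comm_group ?P"
    by (intro group.group_comm_groupI group_palette_group pal) (simp add: mult.commute)
  then obtain h where h: "h \<in> hom ?F ?P"
    and hab: "\<And>k. k \<in> {..<2} \<Longrightarrow> h (frag_of k) = (if k = 0 then a else b)"
    using comm_group.free_Abelian_group_universal[of ?P "\<lambda>k. if k = 0 then a else b" "{..<2}"] G
    by (auto split: if_splits)
  have gens: "h (surgery_relation (lens_space m n) k) = 1" if "k < 2" for k
  proof -
    have "k = 0 \<or> k = 1" using that by auto
    then show ?thesis
      using hab rel G palette_nonzero[OF pal]
      by (auto simp: hom_surgery_relation[OF pal h] simp del: single_one One_nat_def)
  qed
  have keysN: "Poly_Mapping.keys x \<subseteq> {..<2}" if "x \<in> ?N" for x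
    using subsetD[OF subgroup.subset[OF N(1)] that] by simp
  have ker: "h x = 1" if "x \<in> ?N" for x
  proof -
    have "group_hom ?F ?P h"
      using h pal by (simp add: group_hom_def group_hom_axioms_def group_palette_group)
    then have "subgroup (kernel ?F ?P h) ?F" by (rule group_hom.subgroup_kernel)
    moreover have "surgery_relation (lens_space m n) ` {..<2} \<subseteq> kernel ?F ?P h"
      using gens surgery_relation_in_carrier[of "lens_space m n"] by (auto simp: kernel_def)
    ultimately have "?N \<subseteq> kernel ?F ?P h"
      unfolding surgery_relations_def components_lens_space
      by (intro group.generate_subgroup_incl) simp_all
    then show ?thesis using that by (auto simp: kernel_def)
  qed
  have "h x = h y" if "x \<in> carrier ?F" "y \<in> carrier ?F" "?N #>\<^bsub>?F\<^esub> x = ?N #>\<^bsub>?F\<^esub> y" for x y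
  proof -
    have "x \<in> ?N #>\<^bsub>?F\<^esub> y"
      using group.rcos_self[OF group_free_Abelian_group that(1) N(1)] that by simp
    then obtain r where r: "r \<in> ?N" "x = r + y" by (auto simp: r_coset_def)
    then show ?thesis using hom_add[OF pal h, of r y] keysN ker that by simp
  qed
  then obtain \<omega> where \<omega>: "\<omega> \<in> hom (?F Mod ?N) ?P" "\<And>x. x \<in> carrier ?F \<Longrightarrow> \<omega> (?N #>\<^bsub>?F\<^esub> x) = h x"
    using FactGroup_universal[OF h N(2)] by blast
  have a: "\<omega> (meridian (lens_space m n) 0) = a"
    using \<omega>(2)[of "frag_of 0"] hab[of 0] by (simp add: meridian_def)
  moreover have "meridian (lens_space m n) 0 \<in> carrier (?F Mod ?N)"
    by (auto simp: meridian_def carrier_FactGroup)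
  ultimately have "nontrivial_class B G (lens_space m n) \<omega>"
    unfolding nontrivial_class_def H1_def using \<omega>(1) \<open>a \<noteq> 1\<close> by auto
  then show thesis using a by (rule that)
qed

section \<open>Comparison of absolute values\<close>

lemma norm_dfac:
  assumes "norm (t :: complex) = 1"
  shows "norm (dfac t) = 1 / norm (t ^ 4 - 1)"
proof -
  have "t \<noteq> 0" using assms by auto
  then have "t\<^sup>2 - t powi (-2) = (t ^ 4 - 1) / t\<^sup>2"
    by (simp add: power_int_minus field_simps power2_eq_square power4_eq_xxxx)
  then show ?thesis using assms by (simp add: dfac_def norm_divide norm_power)
qed

lemma norm_Alexander_manifold_lens_space:
  fixes B G :: "complex set"
  assumes pal: "manifold_palette B G" and \<omega>: "nontrivial_class B G (lens_space m n) \<omega>"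
  defines "a \<equiv> \<omega> (meridian (lens_space m n) 0)" and "b \<equiv> \<omega> (meridian (lens_space m n) 1)"
  assumes "norm a = 1" "norm b = 1" "a ^ 4 \<noteq> 1"
  shows "norm (Alexander_manifold B G (lens_space m n) \<omega>) = 1 / (norm (a ^ 4 - 1) * norm (b ^ 4 - 1))"
proof -
  have "one_palette B G" using pal by (simp add: manifold_palette_def)
  note ab = cohomology_class_meridians[OF this \<omega>, folded a_def b_def]
  have "computable_presentation B G (lens_space m n) \<omega>"
    using \<omega> ab by (auto simp: computable_presentation_def link_diagram_lens_space a_def b_def
        numeral_2_eq_2 less_Suc_eq)
  moreover have "Kirby_Alexander (lens_space m n) (\<lambda>k. (\<omega> (meridian (lens_space m n) k), 1))
      = - 4 * dfac a * dfac b"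
    using assms(5-7) ab by (intro Kirby_Alexander_lens_space) (auto simp: a_def b_def)
  ultimately have "norm (Alexander_manifold B G (lens_space m n) \<omega>) = norm (dfac a) * norm (dfac b)"
    using pal by (simp add: Alexander_manifold_def norm_divide norm_mult norm_power)
  then show ?thesis using assms(5,6) by (simp add: norm_dfac)
qed

lemma norm_cis_minus_1: "(norm (cis x - 1))\<^sup>2 = 2 - 2 * cos x"
proof -
  have "(norm (cis x - 1))\<^sup>2 = (cos x - 1)\<^sup>2 + (sin x)\<^sup>2" by (simp add: cmod_power2)
  also have "\<dots> = 2 - 2 * cos x" using sin_cos_squared_add[of x] by (simp add: power2_eq_square algebra_simps)
  finally show ?thesis .
qed

context
  fixes \<xi> :: complex
  assumes \<xi>: "\<xi> = exp (2 * complex_of_real pi * \<i> / 7)"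
begin

lemma root_power_mod: "\<xi> ^ n = \<xi> ^ (n mod 7)"
proof -
  have "\<xi> ^ n = (\<xi> ^ 7) ^ (n div 7) * \<xi> ^ (n mod 7)"
    by (metis mult_div_mod_eq power_add power_mult)
  then show ?thesis by (simp add: root_power_7[OF \<xi>])
qed

lemma chord_reflect: "k \<le> 7 \<Longrightarrow> norm (\<xi> ^ (7 - k) - 1) = norm (\<xi> ^ k - 1)"
proof -
  assume "k \<le> 7"
  then have "\<xi> ^ (7 - k) * \<xi> ^ k = 1" by (simp add: root_power_7[OF \<xi>] flip: power_add)
  then have "\<xi> ^ (7 - k) - 1 = \<xi> ^ (7 - k) * (1 - \<xi> ^ k)" by (simp add: algebra_simps)
  then show ?thesis by (simp add: norm_mult norm_power norm_root[OF \<xi>] norm_minus_commute)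
qed

lemma chord_less: "2 \<le> k \<Longrightarrow> k \<le> 3 \<Longrightarrow> norm (\<xi> - 1) < norm (\<xi> ^ k - 1)"
proof -
  assume "2 \<le> k" "k \<le> 3"
  then have "cos (2 * pi * real k / 7) < cos (2 * pi * real 1 / 7)"
    by (intro cos_monotone_0_pi) auto
  moreover have "(norm (\<xi> ^ j - 1))\<^sup>2 = 2 - 2 * cos (2 * pi * real j / 7)" for j
    using norm_cis_minus_1[of "2 * pi * real j / 7"] by (simp only: root_eq_cis[OF \<xi>])
  from this[of 1] this[of k] have "(norm (\<xi> - 1))\<^sup>2 < (norm (\<xi> ^ k - 1))\<^sup>2"
    using calculation by simp
  then show ?thesis using power2_less_imp_less[of "norm (\<xi> - 1)" "norm (\<xi> ^ k - 1)"] by simp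
qed

lemma chord_products:
  assumes "k \<in> {1..6}"
  shows "norm (\<xi> - 1) * norm (\<xi> - 1) < norm (\<xi> ^ (4 * k) - 1) * norm (\<xi> ^ (16 * k) - 1)"
proof -
  let ?c = "\<lambda>k. norm (\<xi> ^ k - 1)"
  have c: "?c 6 = ?c 1" "?c 5 = ?c 2" "?c 4 = ?c 3"
    using chord_reflect[of 1] chord_reflect[of 2] chord_reflect[of 3] by simp_all
  have l: "?c 1 < ?c 2" "?c 1 < ?c 3" using chord_less[of 2] chord_less[of 3] by simp_all
  have "?c 1 \<noteq> 0"
  proof
    assume "?c 1 = 0"
    then have "\<xi> = 1" by simp
    then show False using l by simp
  qed
  then have pos: "0 < ?c 1" by simp
  have "?c 1 * ?c 1 < ?c 1 * ?c 2" "?c 1 * ?c 1 < ?c 1 * ?c 3" "?c 1 * ?c 1 < ?c 2 * ?c 3"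
    using l pos by (auto intro!: mult_strict_mono mult_strict_left_mono)
  moreover have "k = 1 \<or> k = 2 \<or> k = 3 \<or> k = 4 \<or> k = 5 \<or> k = 6" using assms by auto
  ultimately show ?thesis
    using c root_power_mod[of "4 * k"] root_power_mod[of "16 * k"] by (elim disjE) (simp_all add: mult.commute)
qed

lemma root_of_unity_7:
  assumes "z ^ 7 = 1" "z \<noteq> 1"
  obtains k where "k \<in> {1..6}" "z = \<xi> ^ k"
proof -
  have "(\<lambda>k. cis (2 * pi * real k / 7)) ` {..<7} = {z. z ^ 7 = 1}"
    using bij_betw_imp_surj_on[OF bij_betw_roots_unity[of 7]] by simp
  then have "z \<in> (\<lambda>k. cis (2 * pi * real k / 7)) ` {..<7}" using assms(1) by simp
  then obtain k where k: "k < 7" "z = \<xi> ^ k"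
    by (auto simp: root_eq_cis[OF \<xi>])
  have "k \<noteq> 0" using k assms(2) by (cases k) auto
  with k show thesis by (intro that[of k]) auto
qed

end

theorem proposition5p2:
  fixes \<xi> :: complex and B G :: "complex set"
  assumes "\<xi> = exp (2 * complex_of_real pi * \<i> / 7)"
    and "B = generate_field ring_of_type_algebra {complex_of_real pi, \<xi>}"
    and "G = generate (field_units B) {complex_of_real pi, \<xi>}"
  shows "\<exists>\<omega>\<^sub>0. nontrivial_class B G (lens_space 8 1) \<omega>\<^sub>0 \<and>
           (\<forall>\<omega>. nontrivial_class B G (lens_space 4 2) \<omega> \<longrightarrow>
              Alexander_manifold B G (lens_space 8 1) \<omega>\<^sub>0
                \<noteq> Alexander_manifold B G (lens_space 4 2) \<omega>)"
proof -
  note \<xi> = assms(1)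
  have pal: "manifold_palette B G" by (rule manifold_palette_BG[OF assms])
  then have pal1: "one_palette B G" by (simp add: manifold_palette_def)
  have pow8: "\<xi> ^ 8 = \<xi>" and pow16: "\<xi> ^ 16 = \<xi>\<^sup>2"
    using root_power_mod[OF \<xi>, of 8] root_power_mod[OF \<xi>, of 16] by simp_all
  have chord: "norm (\<xi> - 1) < norm (\<xi>\<^sup>2 - 1)" by (rule chord_less[OF \<xi>]) simp_all
  then have ne: "\<xi>\<^sup>2 \<noteq> 1" "\<xi> \<noteq> 1" using norm_ge_zero[of "\<xi> - 1"] by auto
  have "\<xi> \<in> G" by (rule generators_in_G(2)[OF assms])
  then have "\<xi>\<^sup>2 \<in> G"
    using generate.eng[of \<xi> "field_units B" _ \<xi>] by (simp add: assms(3) power2_eq_square)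
  then obtain \<omega>0 where \<omega>0: "nontrivial_class B G (lens_space 8 1) \<omega>0"
    and a0: "\<omega>0 (meridian (lens_space 8 1) 0) = \<xi>\<^sup>2"
    using cohomology_class_exists[OF pal1, of "\<xi>\<^sup>2" "\<xi>\<^sup>2" 8 1] ne pow16 by (auto simp flip: power_mult)
  have b0: "\<omega>0 (meridian (lens_space 8 1) 1) = \<xi>\<^sup>2"
    using cohomology_class_meridians(4)[OF pal1 \<omega>0] a0 by simp
  have val0: "norm (Alexander_manifold B G (lens_space 8 1) \<omega>0) = 1 / (norm (\<xi> - 1) * norm (\<xi> - 1))"
    using norm_Alexander_manifold_lens_space[OF pal \<omega>0] a0 b0 pow8 ne
    by (simp add: norm_power norm_root[OF \<xi>] flip: power_mult)
  have "Alexander_manifold B G (lens_space 8 1) \<omega>0 \<noteq> Alexander_manifold B G (lens_space 4 2) \<omega>"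
    if \<omega>: "nontrivial_class B G (lens_space 4 2) \<omega>" for \<omega>
  proof -
    define a b where "a = \<omega> (meridian (lens_space 4 2) 0)" and "b = \<omega> (meridian (lens_space 4 2) 1)"
    note ab = cohomology_class_meridians[OF pal1 \<omega>, folded a_def b_def]
    have "a ^ 7 * a = (a ^ 4)\<^sup>2" by (simp flip: power_Suc2 power_mult)
    then have "a ^ 7 * a = a" by (simp add: ab(3,4))
    then have "a ^ 7 = 1" using palette_nonzero[OF pal1 ab(1)] by simp
    then obtain k where k: "k \<in> {1..6}" "a = \<xi> ^ k" using root_of_unity_7[OF \<xi>] ab(5) by blast
    have a4: "a ^ 4 = \<xi> ^ (4 * k)" and b4: "b ^ 4 = \<xi> ^ (16 * k)"
      using k(2) ab(3) by (auto simp: mult.commute simp flip: power_mult)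
    have less: "norm (\<xi> - 1) * norm (\<xi> - 1) < norm (a ^ 4 - 1) * norm (b ^ 4 - 1)"
      unfolding a4 b4 by (rule chord_products[OF \<xi> k(1)])
    have "norm a = 1" "norm b = 1"
      using ab(3) by (auto simp: k(2) norm_power norm_root[OF \<xi>])
    then have "norm (Alexander_manifold B G (lens_space 4 2) \<omega>) = 1 / (norm (a ^ 4 - 1) * norm (b ^ 4 - 1))"
      using norm_Alexander_manifold_lens_space[OF pal \<omega>] ab(3,6) by (simp add: a_def b_def)
    also have "\<dots> < 1 / (norm (\<xi> - 1) * norm (\<xi> - 1))"
    proof -
      have pos: "0 < norm (\<xi> - 1) * norm (\<xi> - 1)" using ne by simp
      show ?thesis
        by (intro divide_strict_left_mono less mult_pos_pos less_trans[OF pos less] pos) simp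
    qed
    finally show ?thesis using val0 by auto
  qed
  with \<omega>0 show ?thesis by blast
qed

end
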